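(* For every pair of positive integers $g,k$, there is a graph $G_{g,k}$ with girth at least $g$ and chromatic number at least $k$ that has a proper edge-colouring in which each cycle contains no colour exactly once.
   Context: A proper edge-colouring assigns colours to edges so that edges sharing a vertex receive distinct colours. "Each cycle contains no colour exactly once" means: for every cycle $C$ of the graph and every colour $c$, the number of edges of $C$ with colour $c$ is not equal to $1$. Graphs are finite and simple. *)

theory Defs
  imports Main
begin

definition simple_graph :: "'a set \<Rightarrow> ('a \<Rightarrow> 'a \<Rightarrow> bool) \<Rightarrow> bool" where
  "simple_graph V E \<longleftrightarrow> finite V \<and> (\<forall>x y. E x y \<longrightarrow> E y x)
     \<and> (\<forall>x. \<not> E x x) \<and> (\<forall>x y. E x y \<longrightarrow> x \<in> V \<and> y \<in> V)"

definition edges :: "'a set \<Rightarrow> ('a \<Rightarrow> 'a \<Rightarrow> bool) \<Rightarrow> 'a set set" where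
  "edges V E = {{x, y} | x y. x \<in> V \<and> y \<in> V \<and> E x y}"

definition is_cycle :: "'a set \<Rightarrow> ('a \<Rightarrow> 'a \<Rightarrow> bool) \<Rightarrow> 'a list \<Rightarrow> bool" where
  "is_cycle V E cs \<longleftrightarrow> length cs \<ge> 3 \<and> distinct cs \<and> set cs \<subseteq> V
     \<and> (\<forall>i < length cs. E (cs ! i) (cs ! ((i + 1) mod length cs)))"

definition cycle_edges :: "'a list \<Rightarrow> 'a set set" where
  "cycle_edges cs = {{cs ! i, cs ! ((i + 1) mod length cs)} | i. i < length cs}"

text \<open>Girth at least g: every cycle has length at least g (acyclic graphs have infinite girth).\<close>
definition girth_at_least :: "'a set \<Rightarrow> ('a \<Rightarrow> 'a \<Rightarrow> bool) \<Rightarrow> nat \<Rightarrow> bool" where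
  "girth_at_least V E g \<longleftrightarrow> (\<forall>cs. is_cycle V E cs \<longrightarrow> length cs \<ge> g)"

definition proper_vertex_colouring :: "'a set \<Rightarrow> ('a \<Rightarrow> 'a \<Rightarrow> bool) \<Rightarrow> ('a \<Rightarrow> nat) \<Rightarrow> nat \<Rightarrow> bool" where
  "proper_vertex_colouring V E c n \<longleftrightarrow> (\<forall>x\<in>V. c x < n) \<and> (\<forall>x y. E x y \<longrightarrow> c x \<noteq> c y)"

definition chromatic_number :: "'a set \<Rightarrow> ('a \<Rightarrow> 'a \<Rightarrow> bool) \<Rightarrow> nat" where
  "chromatic_number V E = (LEAST n. \<exists>c. proper_vertex_colouring V E c n)"

definition proper_edge_colouring :: "'a set \<Rightarrow> ('a \<Rightarrow> 'a \<Rightarrow> bool) \<Rightarrow> ('a set \<Rightarrow> 'b) \<Rightarrow> bool" where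
  "proper_edge_colouring V E col \<longleftrightarrow>
     (\<forall>e\<in>edges V E. \<forall>f\<in>edges V E. e \<noteq> f \<and> e \<inter> f \<noteq> {} \<longrightarrow> col e \<noteq> col f)"

definition no_colour_once_on_cycles :: "'a set \<Rightarrow> ('a \<Rightarrow> 'a \<Rightarrow> bool) \<Rightarrow> ('a set \<Rightarrow> 'b) \<Rightarrow> bool" where
  "no_colour_once_on_cycles V E col \<longleftrightarrow>
     (\<forall>cs. is_cycle V E cs \<longrightarrow> (\<forall>c. card {e \<in> cycle_edges cs. col e = c} \<noteq> 1))"

end

(* A colouring in which no cycle contains a colour exactly once arises from a map to a Hamming graph
   under which every edge changes exactly one coordinate: colour an edge by that coordinate; a
   cycle cannot change a coordinate exactly once.

   Such graphs of large chromatic number are built by Tutte's construction. Given a graph on V that is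
   not k-colourable, take a hypergraph whose hyperedges are indexed by V and which is not
   (k+1)-colourable, and match a copy of the graph to every hyperedge. A (k+1)-colouring has a
   monochromatic hyperedge, whose copy would be k-coloured. The matching edges at the copy of e get
   the new colour e. The old coordinates extend to the hypergraph when its hyperedges are the
   combinatorial lines of a Hales-Jewett cube over the alphabet V: apply the coordinate letterwise.
   This survives replacing every point by N points, so the hyperedges can be thinned out to a random
   sparse lift, which gives large girth. *)

theory Submission
  imports Defs Complex_Main "HOL-Library.FuncSet" "HOL-Library.Countable"
begin

section \<open>The Hales--Jewett theorem\<close>

definition words :: "'a set \<Rightarrow> nat \<Rightarrow> 'a list set" where
  "words A N = {w. set w \<subseteq> A \<and> length w = N}"

text \<open>A template is a combinatorial line, with \<open>None\<close> marking the active coordinates.\<close>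
definition templates :: "'a set \<Rightarrow> nat \<Rightarrow> 'a option list set" where
  "templates A N = {l. set l \<subseteq> insert None (Some ` A) \<and> length l = N \<and> None \<in> set l}"

definition inst :: "'a option list \<Rightarrow> 'a \<Rightarrow> 'a list" where
  "inst l a = map (case_option a id) l"

lemma inst_append [simp]: "inst (l @ m) a = inst l a @ inst m a"
  by (simp add: inst_def)

lemma inst_map_Some [simp]: "inst (map Some w) a = w"
  by (simp add: inst_def map_idI)

lemma inst_words: "l \<in> templates A N \<Longrightarrow> a \<in> A \<Longrightarrow> inst l a \<in> words A N"
  by (fastforce simp: templates_def words_def inst_def)

lemma append_words: "v \<in> words A N \<Longrightarrow> w \<in> words A M \<Longrightarrow> v @ w \<in> words A (N + M)"
  by (auto simp: words_def)

lemma append_templates: "l \<in> templates A N \<Longrightarrow> m \<in> templates A M \<Longrightarrow> l @ m \<in> templates A (N + M)"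
  by (auto simp: templates_def)

lemma append_words_templates:
  "w \<in> words A N \<Longrightarrow> m \<in> templates A M \<Longrightarrow> map Some w @ m \<in> templates A (N + M)"
  by (auto simp: templates_def words_def)

lemma append_templates_words:
  "l \<in> templates A N \<Longrightarrow> w \<in> words A M \<Longrightarrow> l @ map Some w \<in> templates A (N + M)"
  by (auto simp: templates_def words_def)

lemma templates_mono: "A \<subseteq> B \<Longrightarrow> templates A N \<subseteq> templates B N"
  by (auto simp: templates_def)

lemma words_mono: "A \<subseteq> B \<Longrightarrow> words A N \<subseteq> words B N"
  by (auto simp: words_def)

lemma finite_words: "finite A \<Longrightarrow> finite (words A N)"
  unfolding words_def by (rule finite_lists_length_eq)

definition monochromatic :: "('b \<Rightarrow> 'c) \<Rightarrow> ('a \<Rightarrow> 'b) \<Rightarrow> 'a set \<Rightarrow> bool" where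
  "monochromatic \<chi> f A \<longleftrightarrow> (\<exists>c. \<forall>a\<in>A. \<chi> (f a) = c)"

text \<open>The bound is on the number of colours that occur, not on their values, so a colouring by
  tuples, encoded through \<open>to_nat\<close>, qualifies without renumbering.\<close>

definition hj :: "'a set \<Rightarrow> nat \<Rightarrow> nat \<Rightarrow> bool" where
  "hj A k N \<longleftrightarrow> (\<forall>\<chi> :: 'a list \<Rightarrow> nat. card (\<chi> ` words A N) \<le> k \<longrightarrow>
     (\<exists>l\<in>templates A N. monochromatic \<chi> (inst l) A))"

text \<open>\<open>S\<close> is the set of colours of a family of lines which are monochromatic off the letter \<open>a\<close>
  and all end in the same word \<open>f\<close> at \<open>a\<close>.\<close>
definition focused ::
    "'a set \<Rightarrow> 'a \<Rightarrow> nat \<Rightarrow> ('a list \<Rightarrow> nat) \<Rightarrow> nat set \<Rightarrow> 'a list \<Rightarrow> bool" where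
  "focused A a N \<chi> S f \<longleftrightarrow> f \<in> words (insert a A) N \<and> (\<forall>c\<in>S. \<exists>l\<in>templates (insert a A) N.
     inst l a = f \<and> (\<forall>b\<in>A. \<chi> (inst l b) = c))"

text \<open>Product colouring: give \<open>v\<close> the whole tuple of colours of
  \<open>w @ v\<close>, where \<open>w\<close> runs over all words in \<open>words B N\<close>. At
  most \<open>k ^ card (words B N)\<close> tuples occur, and a line monochromatic for the tuples is
  good for every prefix at once.\<close>

lemma hj_uniform_line:
  fixes \<chi> :: "'a list \<Rightarrow> nat"
  assumes "finite A" and B: "finite B" "A \<subseteq> B"
    and hj: "hj A (k ^ card (words B N)) M"
    and k: "card (\<chi> ` words B (N + M)) \<le> k"
  shows "\<exists>m\<in>templates A M. \<forall>w\<in>words B N. \<forall>a\<in>A. \<forall>b\<in>A. \<chi> (w @ inst m a) = \<chi> (w @ inst m b)"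
proof -
  define K where "K = \<chi> ` words B (N + M)"
  have finK: "finite K" unfolding K_def using finite_words[OF B(1)] by simp
  obtain ws where ws: "set ws = words B N" "distinct ws"
    using finite_distinct_list[OF finite_words[OF B(1)]] by blast
  define \<psi> :: "'a list \<Rightarrow> nat" where "\<psi> v = to_nat (map (\<lambda>w. \<chi> (w @ v)) ws)" for v
  have "\<psi> ` words A M \<subseteq> to_nat ` {xs. set xs \<subseteq> K \<and> length xs = length ws}"
  proof
    fix y assume "y \<in> \<psi> ` words A M"
    then obtain v where v: "v \<in> words A M" "y = \<psi> v" by blast
    have "v \<in> words B M" using v words_mono[OF B(2)] by blast
    then have "set (map (\<lambda>w. \<chi> (w @ v)) ws) \<subseteq> K"
      using ws append_words unfolding K_def by fastforce
    then show "y \<in> to_nat ` {xs. set xs \<subseteq> K \<and> length xs = length ws}"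
      using v unfolding \<psi>_def by auto
  qed
  then have "card (\<psi> ` words A M) \<le> card (to_nat ` {xs. set xs \<subseteq> K \<and> length xs = length ws})"
    by (intro card_mono finite_imageI finite_lists_length_eq finK)
  also have "\<dots> \<le> card {xs. set xs \<subseteq> K \<and> length xs = length ws}"
    by (intro card_image_le finite_lists_length_eq finK)
  also have "\<dots> = card K ^ length ws" by (rule card_lists_length_eq[OF finK])
  also have "\<dots> \<le> k ^ card (words B N)"
    using k ws distinct_card[of ws] by (simp add: K_def power_mono)
  finally obtain m where m: "m \<in> templates A M" "monochromatic \<psi> (inst m) A"
    using hj unfolding hj_def by blast
  have "\<chi> (w @ inst m a) = \<chi> (w @ inst m b)" if "w \<in> words B N" "a \<in> A" "b \<in> A" for w a b
  proof -
    have "\<psi> (inst m a) = \<psi> (inst m b)" using m(2) that unfolding monochromatic_def by auto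
    then have "map (\<lambda>w. \<chi> (w @ inst m a)) ws = map (\<lambda>w. \<chi> (w @ inst m b)) ws"
      unfolding \<psi>_def by simp
    then show ?thesis using that ws by simp
  qed
  with m(1) show ?thesis by blast
qed

text \<open>Induction on the size \<open>r\<close> of the focused family: append a block on which
  the colour ignores the letters of \<open>A\<close>. For \<open>r > k\<close> the second
  alternative is impossible, which is what the Hales-Jewett theorem needs.\<close>

lemma colour_focusing:
  assumes A: "finite A" "A \<noteq> {}" "a \<notin> A" and hj: "\<And>k. \<exists>N. hj A k N"
  shows "\<exists>N. \<forall>\<chi>. card (\<chi> ` words (insert a A) N) \<le> k \<longrightarrow>
    (\<exists>l\<in>templates (insert a A) N. monochromatic \<chi> (inst l) (insert a A)) \<or>
    (\<exists>S f. card S = r \<and> finite S \<and> focused A a N \<chi> S f)"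
proof (induction r)
  case 0
  show ?case
    by (intro exI[of _ 0] allI impI disjI2 exI[of _ "{}"] exI[of _ "[]"])
      (auto simp: focused_def words_def)
next
  case (Suc r)
  let ?B = "insert a A"
  obtain b where b: "b \<in> A" using A by blast
  have B: "finite ?B" "A \<subseteq> ?B" using A by auto
  obtain N where N: "\<forall>\<chi>. card (\<chi> ` words ?B N) \<le> k \<longrightarrow>
      (\<exists>l\<in>templates ?B N. monochromatic \<chi> (inst l) ?B) \<or>
      (\<exists>S f. card S = r \<and> finite S \<and> focused A a N \<chi> S f)"
    using Suc by (rule exE)
  obtain M where M: "hj A (k ^ card (words ?B N)) M" using hj by blast
  show ?case
  proof (intro exI[of _ "N + M"] allI impI)
    fix \<chi> :: "'a list \<Rightarrow> nat" assume k: "card (\<chi> ` words ?B (N + M)) \<le> k"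
    obtain m where m: "m \<in> templates A M"
      and uni: "\<forall>w\<in>words ?B N. \<forall>x\<in>A. \<forall>y\<in>A. \<chi> (w @ inst m x) = \<chi> (w @ inst m y)"
      using hj_uniform_line[OF A(1) B M k] by (rule bexE)
    have mB: "m \<in> templates ?B M" using m templates_mono[OF B(2)] by blast
    have mb: "inst m b \<in> words ?B M" using inst_words[OF mB] b by simp
    \<comment> \<open>By \<open>uni\<close>, the suffix at \<open>b\<close> stands for the suffix at
      every letter of \<open>A\<close>; only the letter \<open>a\<close> is out of control.\<close>
    define \<psi> where "\<psi> w = \<chi> (w @ inst m b)" for w
    have "\<psi> ` words ?B N \<subseteq> \<chi> ` words ?B (N + M)"
      unfolding \<psi>_def using append_words[OF _ mb] by auto
    then have "card (\<psi> ` words ?B N) \<le> card (\<chi> ` words ?B (N + M))"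
      by (intro card_mono finite_imageI finite_words B(1))
    with k have "card (\<psi> ` words ?B N) \<le> k" by simp
    with N have "(\<exists>l\<in>templates ?B N. monochromatic \<psi> (inst l) ?B) \<or>
      (\<exists>S f. card S = r \<and> finite S \<and> focused A a N \<psi> S f)" by simp
    then
    consider (mono) l c where "l \<in> templates ?B N" "\<forall>x\<in>?B. \<psi> (inst l x) = c"
      | (foc) S f where "card S = r" "finite S" "focused A a N \<psi> S f"
      unfolding monochromatic_def by blast
    then show "(\<exists>l\<in>templates ?B (N + M). monochromatic \<chi> (inst l) ?B) \<or>
       (\<exists>S f. card S = Suc r \<and> finite S \<and> focused A a (N + M) \<chi> S f)"
    proof cases
      case mono
      have "l @ map Some (inst m b) \<in> templates ?B (N + M)"
        using mono mb append_templates_words by blast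
      moreover have "\<forall>x\<in>?B. \<chi> (inst (l @ map Some (inst m b)) x) = c"
        using mono by (simp add: \<psi>_def)
      ultimately show ?thesis unfolding monochromatic_def by blast
    next
      case foc
      then have f: "f \<in> words ?B N" by (simp add: focused_def)
      show ?thesis
      \<comment> \<open>If the colour of the focus belongs to the family, the line with that colour
        has it at \<open>a\<close> too and is monochromatic on the whole alphabet. Otherwise this
        colour is new and supplies the extra line.\<close>
      proof (cases "\<psi> f \<in> S")
        case True
        with foc obtain l where l: "l \<in> templates ?B N" "inst l a = f" "\<forall>x\<in>A. \<psi> (inst l x) = \<psi> f"
          unfolding focused_def by blast
        have "l @ map Some (inst m b) \<in> templates ?B (N + M)"
          using l mb append_templates_words by blast
        moreover have "\<forall>x\<in>?B. \<chi> (inst (l @ map Some (inst m b)) x) = \<psi> f"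
          using l by (simp add: \<psi>_def)
        ultimately show ?thesis unfolding monochromatic_def by blast
      next
        case False
        have "focused A a (N + M) \<chi> (insert (\<psi> f) S) (f @ inst m a)"
          unfolding focused_def
        proof (intro conjI ballI)
          show "f @ inst m a \<in> words ?B (N + M)"
            using f inst_words[OF mB] append_words by blast
        next
          fix c assume c: "c \<in> insert (\<psi> f) S"
          show "\<exists>l\<in>templates ?B (N + M). inst l a = f @ inst m a \<and> (\<forall>x\<in>A. \<chi> (inst l x) = c)"
          proof (cases "c = \<psi> f")
            case True
            \<comment> \<open>The new line keeps the first block at \<open>f\<close> and moves only
              in the second.\<close>
            have "\<chi> (inst (map Some f @ m) x) = c" if "x \<in> A" for x
              using uni[rule_format, OF f that b] True by (simp add: \<psi>_def)
            then show ?thesis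
              using append_words_templates[OF f mB] by (intro bexI[of _ "map Some f @ m"]) auto
          next
            case False
            then obtain l where l: "l \<in> templates ?B N" "inst l a = f" "\<forall>x\<in>A. \<psi> (inst l x) = c"
              using c foc unfolding focused_def by blast
            \<comment> \<open>An old line now moves in both blocks together; \<open>uni\<close>
              replaces the letter \<open>x\<close> in the second block by \<open>b\<close>, which
              leaves \<open>\<psi>\<close>.\<close>
            have "\<chi> (inst (l @ m) x) = c" if "x \<in> A" for x
              using uni[rule_format, OF inst_words[OF l(1)] that b, of x] l(3) that by (simp add: \<psi>_def)
            then show ?thesis
              using append_templates[OF l(1) mB] l by (intro bexI[of _ "l @ m"]) auto
          qed
        qed
        moreover have "card (insert (\<psi> f) S) = Suc r" using foc False by simp
        ultimately show ?thesis using foc by blast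
      qed
    qed
  qed
qed

text \<open>Induction on the alphabet with \<open>k\<close> arbitrary, since focusing calls the
  smaller alphabet with far more colours. A focused family of \<open>Suc k\<close> colours cannot
  exist, because each of its colours occurs on some word.\<close>

theorem hales_jewett: "finite A \<Longrightarrow> \<exists>N. hj A k N"
proof (induction A arbitrary: k rule: finite_induct)
  case empty
  have "[None] \<in> templates {} 1" by (simp add: templates_def)
  then have "hj {} k 1" unfolding hj_def monochromatic_def by blast
  then show ?case by blast
next
  case (insert a A)
  show ?case
  proof (cases "A = {}")
    \<comment> \<open>A one-letter alphabet is treated separately because focusing needs a letter
      besides \<open>a\<close>; here every line is monochromatic.\<close>
    case True
    have "[None] \<in> templates {a} 1" by (simp add: templates_def)
    then have "hj {a} k 1" unfolding hj_def monochromatic_def by blast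
    then show ?thesis using True by blast
  next
    case False
    then obtain b where b: "b \<in> A" by blast
    obtain N where N: "\<forall>\<chi>. card (\<chi> ` words (insert a A) N) \<le> k \<longrightarrow>
        (\<exists>l\<in>templates (insert a A) N. monochromatic \<chi> (inst l) (insert a A)) \<or>
        (\<exists>S f. card S = Suc k \<and> finite S \<and> focused A a N \<chi> S f)"
      using colour_focusing[OF insert(1) False insert(2) insert(3), of k "Suc k"] by (rule exE)
    have no_focus: "\<not> focused A a N \<chi> S f"
      if "card (\<chi> ` words (insert a A) N) \<le> k" "card S = Suc k" for \<chi> S f
    proof
      assume foc: "focused A a N \<chi> S f"
      have "S \<subseteq> \<chi> ` words (insert a A) N"
      proof
        fix c assume "c \<in> S"
        then obtain l where "l \<in> templates (insert a A) N" "\<chi> (inst l b) = c"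
          using foc b unfolding focused_def by blast
        then show "c \<in> \<chi> ` words (insert a A) N"
          using b by (intro image_eqI[of _ _ "inst l b"] inst_words) auto
      qed
      then have "card S \<le> card (\<chi> ` words (insert a A) N)"
        using insert(1) by (intro card_mono) (auto simp: finite_words)
      with that show False by simp
    qed
    show ?thesis unfolding hj_def
    proof (intro exI[of _ N] allI impI)
      fix \<chi> :: "'a list \<Rightarrow> nat" assume k: "card (\<chi> ` words (insert a A) N) \<le> k"
      then show "\<exists>l\<in>templates (insert a A) N. monochromatic \<chi> (inst l) (insert a A)"
        using N[rule_format, OF k] no_focus[OF k] by metis
    qed
  qed
qed

section \<open>Sparse blow-ups of hypergraphs\<close>

text \<open>The sum factorises over the entries of \<open>s\<close>, each contributing 1/2 on a hit
  and 1 otherwise. This exponential moment later controls, in the manner of Markov's inequality, the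
  sequences with few hits.\<close>

lemma sum_half_power_hits:
  assumes T: "finite T" and A: "A \<subseteq> T"
  shows "(\<Sum>s\<in>{..<M} \<rightarrow>\<^sub>E T. (1/2::real) ^ card {i\<in>{..<M}. s i \<in> A}) = (card T - card A / 2) ^ M"
proof -
  have "(1/2::real) ^ card {i\<in>{..<M}. s i \<in> A} = (\<Prod>i<M. if s i \<in> A then 1/2 else 1)" for s
    using prod.inter_filter[of "{..<M}" "\<lambda>_. 1/2::real" "\<lambda>i. s i \<in> A"] by simp
  then have "(\<Sum>s\<in>{..<M} \<rightarrow>\<^sub>E T. (1/2::real) ^ card {i\<in>{..<M}. s i \<in> A})
      = (\<Sum>s\<in>{..<M} \<rightarrow>\<^sub>E T. \<Prod>i<M. if s i \<in> A then 1/2 else 1)" by simp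
  also have "\<dots> = (\<Prod>i<M. \<Sum>y\<in>T. if y \<in> A then 1/2 else 1)"
    using T by (intro prod_sum_PiE[symmetric]) auto
  also have "(\<Sum>y\<in>T. if y \<in> A then 1/2 else 1 :: real) = (\<Sum>y\<in>T. 1 - (if y \<in> A then 1/2 else 0))"
    by (intro sum.cong) auto
  also have "\<dots> = card T - card A / 2"
    using A T by (simp add: sum_subtractf sum.inter_filter[symmetric] Collect_conj_eq Int_absorb1)
  finally show ?thesis by simp
qed

lemma card_PiE_restricted:
  assumes "finite T" "Q \<subseteq> T" "J \<subseteq> {..<M}"
  shows "card {s \<in> {..<M} \<rightarrow>\<^sub>E T. \<forall>i\<in>J. s i \<in> Q} = card Q ^ card J * card T ^ (M - card J)"
proof -
  have fJ: "finite J" using assms(3) finite_subset by blast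
  have "{s \<in> {..<M} \<rightarrow>\<^sub>E T. \<forall>i\<in>J. s i \<in> Q} = (\<Pi>\<^sub>E i\<in>{..<M}. if i \<in> J then Q else T)"
    using assms by (fastforce simp: PiE_iff split: if_splits)
  then have "card {s \<in> {..<M} \<rightarrow>\<^sub>E T. \<forall>i\<in>J. s i \<in> Q} = (\<Prod>i<M. card (if i \<in> J then Q else T))"
    by (simp add: card_PiE)
  also have "\<dots> = (\<Prod>i\<in>{..<M} \<inter> J. card Q) * (\<Prod>i\<in>{..<M} \<inter> - J. card T)"
    by (simp add: prod.If_cases if_distrib[of card])
  also have "{..<M} \<inter> J = J" using assms by blast
  also have "{..<M} \<inter> - J = {..<M} - J" by blast
  finally show ?thesis using assms fJ by (simp add: card_Diff_subset)
qed

text \<open>Covering sets of at most \<open>r\<close> points by ranges of functions on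
  \<open>{..<r}\<close>, with a fixed point as padding, leaves only \<open>card U ^ r\<close>
  candidates in a union bound.\<close>

lemma covered_by_function:
  assumes "finite W" "W \<subseteq> U" "card W \<le> r" "U \<noteq> {}"
  shows "\<exists>w \<in> {..<r} \<rightarrow>\<^sub>E U. W \<subseteq> w ` {..<r}"
proof -
  obtain u where u: "u \<in> U" using assms by blast
  obtain f where f: "bij_betw f {..<card W} W"
    using ex_bij_betw_nat_finite[OF assms(1)] by (auto simp: atLeast0LessThan)
  define w where "w = restrict (\<lambda>i. if i < card W then f i else u) {..<r}"
  have "f i \<in> U" if "i < card W" for i
    using f that assms(2) by (auto simp: bij_betw_def)
  then have "w \<in> {..<r} \<rightarrow>\<^sub>E U"
    using u by (simp add: w_def)
  moreover have "W \<subseteq> w ` {..<r}"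
  proof
    fix x assume "x \<in> W"
    then have "x \<in> f ` {..<card W}" using f by (simp add: bij_betw_def)
    then obtain i where "i < card W" "f i = x" by auto
    then show "x \<in> w ` {..<r}" using assms(3) by (intro image_eqI[of _ _ i]) (auto simp: w_def)
  qed
  ultimately show ?thesis by blast
qed

text \<open>Union bound over the candidates \<open>W\<close> for a small set containing every
  \<open>pts (s i)\<close> with \<open>i\<close> in \<open>J\<close>: for each \<open>W\<close> an
  entry in \<open>J\<close> has at most \<open>\<beta>\<close> choices, and the other entries are
  free.\<close>

lemma card_crowded_sequences:
  assumes T: "finite T" and U: "finite U" "U \<noteq> {}" and pts: "\<And>t. t \<in> T \<Longrightarrow> pts t \<subseteq> U"
    and \<beta>: "\<And>W. W \<subseteq> U \<Longrightarrow> card W \<le> r \<Longrightarrow> card {t\<in>T. pts t \<subseteq> W} \<le> \<beta>"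
    and J: "J \<subseteq> {..<M}"
  shows "card {s \<in> {..<M} \<rightarrow>\<^sub>E T. card (\<Union>i\<in>J. pts (s i)) \<le> r}
    \<le> card U ^ r * (\<beta> ^ card J * card T ^ (M - card J))"
proof -
  let ?F = "{..<r} \<rightarrow>\<^sub>E U"
  let ?S = "\<lambda>w. {s \<in> {..<M} \<rightarrow>\<^sub>E T. \<forall>i\<in>J. s i \<in> {t\<in>T. pts t \<subseteq> w ` {..<r}}}"
  have fin: "finite ?F" "finite ({..<M} \<rightarrow>\<^sub>E T)" using U T by (auto intro!: finite_PiE)
  have sub: "{s \<in> {..<M} \<rightarrow>\<^sub>E T. card (\<Union>i\<in>J. pts (s i)) \<le> r} \<subseteq> (\<Union>w\<in>?F. ?S w)"
  proof
    fix s assume s: "s \<in> {s \<in> {..<M} \<rightarrow>\<^sub>E T. card (\<Union>i\<in>J. pts (s i)) \<le> r}"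
    then have sT: "s i \<in> T" if "i \<in> J" for i using that J by auto
    have "(\<Union>i\<in>J. pts (s i)) \<subseteq> U" using sT pts by blast
    then obtain w where "w \<in> ?F" "(\<Union>i\<in>J. pts (s i)) \<subseteq> w ` {..<r}"
      using covered_by_function[of "\<Union>i\<in>J. pts (s i)" U r] U s finite_subset by blast
    then show "s \<in> (\<Union>w\<in>?F. ?S w)" using s sT by blast
  qed
  have "card (?S w) \<le> \<beta> ^ card J * card T ^ (M - card J)" if "w \<in> ?F" for w
  proof -
    have "w ` {..<r} \<subseteq> U" using that by auto
    moreover have "card (w ` {..<r}) \<le> r" using card_image_le[of "{..<r}" w] by simp
    ultimately have "card {t\<in>T. pts t \<subseteq> w ` {..<r}} \<le> \<beta>" by (rule \<beta>)
    then show ?thesis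
      by (subst card_PiE_restricted[OF T _ J]) (auto intro!: mult_right_mono power_mono)
  qed
  then have "(\<Sum>w\<in>?F. card (?S w)) \<le> card ?F * (\<beta> ^ card J * card T ^ (M - card J))"
    using sum_bounded_above[of ?F "\<lambda>w. card (?S w)"] by simp
  moreover have "card (\<Union>w\<in>?F. ?S w) \<le> (\<Sum>w\<in>?F. card (?S w))"
    by (rule card_UN_le[OF fin(1)])
  moreover have "card {s \<in> {..<M} \<rightarrow>\<^sub>E T. card (\<Union>i\<in>J. pts (s i)) \<le> r} \<le> card (\<Union>w\<in>?F. ?S w)"
    using fin by (intro card_mono sub) auto
  moreover have "card ?F = card U ^ r" by (simp add: card_PiE)
  ultimately show ?thesis by simp
qed

text \<open>Give each point \<open>x\<close> a colour that fills at least \<open>n\<close> of its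
  \<open>k * n\<close> copies. A hyperedge monochromatic for these colours has at least
  \<open>n ^ card V\<close> monochromatic lifts, a share of all lifts that is bounded below
  independently of \<open>n\<close>.\<close>

lemma blow_up_supersaturation:
  fixes \<chi> :: "'x \<times> nat \<Rightarrow> nat"
  assumes V: "finite V" and H: "finite H" "H \<subseteq> V \<rightarrow> X"
    and k: "k \<ge> 1"
    and ncol: "\<forall>\<chi> :: 'x \<Rightarrow> nat. (\<forall>x\<in>X. \<chi> x < k) \<longrightarrow> (\<exists>h\<in>H. monochromatic \<chi> h V)"
    and \<chi>: "\<And>p. p \<in> X \<times> {..<k * n} \<Longrightarrow> \<chi> p < k"
  shows "card (H \<times> (V \<rightarrow>\<^sub>E {..<k * n})) \<le> (card H * k ^ card V) *
    card {(h, t) \<in> H \<times> (V \<rightarrow>\<^sub>E {..<k * n}). monochromatic \<chi> (\<lambda>v. (h v, t v)) V}"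
proof -
  have HX: "h v \<in> X" if "h \<in> H" "v \<in> V" for h v using H(2) that by auto
  have "\<exists>c<k. n \<le> card {t\<in>{..<k * n}. \<chi> (x, t) = c}" if "x \<in> X" for x
  proof -
    have "\<exists>c\<in>{..<k}. card {..<k * n} \<le> card ((\<lambda>t. \<chi> (x, t)) -` {c} \<inter> {..<k * n}) * card {..<k}"
      using \<chi> that k by (intro pigeonhole_card) (auto simp: lessThan_empty_iff)
    then obtain c where "c < k" "k * n \<le> card ((\<lambda>t. \<chi> (x, t)) -` {c} \<inter> {..<k * n}) * k" by auto
    moreover have "(\<lambda>t. \<chi> (x, t)) -` {c} \<inter> {..<k * n} = {t\<in>{..<k * n}. \<chi> (x, t) = c}" by auto
    ultimately show ?thesis using k by (auto simp: mult.commute)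
  qed
  then obtain \<psi> where \<psi>: "\<And>x. x \<in> X \<Longrightarrow> \<psi> x < k \<and> n \<le> card {t\<in>{..<k * n}. \<chi> (x, t) = \<psi> x}"
    by metis
  then obtain h c where h: "h \<in> H" "\<forall>v\<in>V. \<psi> (h v) = c"
    using ncol[rule_format, of \<psi>] unfolding monochromatic_def by blast
  let ?P = "\<Pi>\<^sub>E v\<in>V. {t\<in>{..<k * n}. \<chi> (h v, t) = c}"
  let ?Mono = "{(h, t) \<in> H \<times> (V \<rightarrow>\<^sub>E {..<k * n}). monochromatic \<chi> (\<lambda>v. (h v, t v)) V}"
  have fin: "finite (H \<times> (V \<rightarrow>\<^sub>E {..<k * n}))" using H V by (auto intro!: finite_PiE)
  have "n ^ card V = (\<Prod>v\<in>V. n)" by simp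
  also have "\<dots> \<le> (\<Prod>v\<in>V. card {t\<in>{..<k * n}. \<chi> (h v, t) = c})"
    using \<psi> h HX by (intro prod_mono) force
  also have "\<dots> = card ({h} \<times> ?P)" using V by (simp add: card_PiE card_cartesian_product)
  also have "\<dots> \<le> card ?Mono"
  proof (rule card_mono)
    show "finite ?Mono" by (rule finite_subset[OF _ fin]) auto
    show "{h} \<times> ?P \<subseteq> ?Mono"
      using h unfolding monochromatic_def by (auto simp: PiE_iff)
  qed
  finally have "n ^ card V \<le> card ?Mono" .
  then have "card H * k ^ card V * n ^ card V \<le> card H * k ^ card V * card ?Mono"
    by (rule mult_left_mono) simp
  then show ?thesis using V by (simp add: card_cartesian_product card_PiE power_mult_distrib)
qed

lemma exists_below_average:
  fixes f :: "'s \<Rightarrow> real"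
  assumes "finite S" "sum f S < card S"
  obtains s where "s \<in> S" "f s < 1"
proof -
  have "\<not> (\<forall>s\<in>S. 1 \<le> f s)" using sum_bounded_below[of S 1 f] assms by auto
  then show ?thesis using that by force
qed

text \<open>The powers of \<open>N\<close> cancel: \<open>j\<close> indices can be chosen in at most
  \<open>(z * N) ^ j\<close> ways, the covering points contribute
  \<open>N ^ ((card V - 1) * j)\<close>, and confining \<open>j\<close> lifts to them saves
  \<open>N ^ (card V * j)\<close>. What remains does not depend on \<open>N\<close>.\<close>

lemma few_crowded_on_average:
  fixes X :: "'x set" and V :: "'a set" and H :: "('a \<Rightarrow> 'x) set" and g z N :: nat
  assumes V: "finite V" "V \<noteq> {}" and X: "finite X" "X \<noteq> {}"
    and H: "finite H" "H \<subseteq> V \<rightarrow> X"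
    and N: "N \<ge> 1"
  defines "T \<equiv> H \<times> (V \<rightarrow>\<^sub>E {..<N})"
    and "pts \<equiv> \<lambda>(h :: 'a \<Rightarrow> 'x, t :: 'a \<Rightarrow> nat). (\<lambda>v. (h v, t v)) ` V"
    and "C \<equiv> card X ^ (card V - 1) * (card V * g) ^ card V"
  shows "(\<Sum>s\<in>{..<z * N} \<rightarrow>\<^sub>E T. card {J \<in> {J. J \<subseteq> {..<z * N} \<and> card J \<in> {1..g}}.
      card (\<Union>i\<in>J. pts (s i)) \<le> (card V - 1) * card J}) \<le> (\<Sum>j=1..g. (z * C) ^ j) * card T ^ (z * N)"
proof -
  have HX: "h v \<in> X" if "h \<in> H" "v \<in> V" for h v using H(2) that by auto
  define M where "M = z * N"
  define n where "n = card V"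
  define \<beta> where "\<beta> = card H * (n * g) ^ n"
  let ?U = "X \<times> {..<N}"
  let ?\<J> = "{J. J \<subseteq> {..<M} \<and> card J \<in> {1..g}}"
  let ?\<Omega> = "{..<M} \<rightarrow>\<^sub>E T"
  let ?B = "\<lambda>j. card ?U ^ ((n - 1) * j) * (\<beta> ^ j * card T ^ (M - j))"
  have n: "n \<ge> 1" using V by (simp add: n_def Suc_le_eq card_gt_0_iff)
  have finT: "finite T" unfolding T_def using V H by (auto intro!: finite_PiE)
  have fin\<Omega>: "finite ?\<Omega>" using finT by (auto intro!: finite_PiE)
  have U: "finite ?U" "?U \<noteq> {}" using X N by (auto simp: lessThan_empty_iff)
  have cardT: "card T = card H * N ^ n"
    using V by (simp add: T_def n_def card_cartesian_product card_PiE)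
  have pts: "pts t \<subseteq> ?U" if "t \<in> T" for t
    using that HX unfolding T_def pts_def by (auto simp: PiE_iff)
  have few: "card {t\<in>T. pts t \<subseteq> W} \<le> \<beta>" if W: "W \<subseteq> ?U" "card W \<le> (n - 1) * j" "j \<le> g" for W j
  proof -
    have finW: "finite W" using W(1) U finite_subset by blast
    \<comment> \<open>A lift inside \<open>W\<close> takes its labels from the second components of
      \<open>W\<close>, while \<open>h\<close> is left free; this gives a bound without
      \<open>N\<close>.\<close>
    have "{t\<in>T. pts t \<subseteq> W} \<subseteq> H \<times> (V \<rightarrow>\<^sub>E snd ` W)"
    proof
      fix p assume p: "p \<in> {t\<in>T. pts t \<subseteq> W}"
      then obtain h t where ht: "p = (h, t)" "h \<in> H" "t \<in> V \<rightarrow>\<^sub>E {..<N}" unfolding T_def by auto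
      then have "(h v, t v) \<in> W" if "v \<in> V" for v using p that unfolding pts_def by auto
      then have "t v \<in> snd ` W" if "v \<in> V" for v using that by force
      then show "p \<in> H \<times> (V \<rightarrow>\<^sub>E snd ` W)" using ht by (simp add: PiE_iff)
    qed
    then have "card {t\<in>T. pts t \<subseteq> W} \<le> card (H \<times> (V \<rightarrow>\<^sub>E snd ` W))"
      using V H finW by (intro card_mono finite_cartesian_product finite_PiE) auto
    also have "\<dots> = card H * card (snd ` W) ^ n"
      using V by (simp add: n_def card_cartesian_product card_PiE)
    also have "card (snd ` W) \<le> n * g"
    proof -
      have "card (snd ` W) \<le> (n - 1) * j" using card_image_le[OF finW, of snd] W(2) by simp
      also have "\<dots> \<le> n * g" using W(3) by (intro mult_mono) auto
      finally show ?thesis .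
    qed
    finally show ?thesis by (simp add: \<beta>_def power_mono)
  qed
  have crowded: "card {s\<in>?\<Omega>. card (\<Union>i\<in>J. pts (s i)) \<le> (n - 1) * card J} \<le> ?B (card J)"
    if "J \<in> ?\<J>" for J
  proof (rule card_crowded_sequences[OF finT U pts])
    show "card {t\<in>T. pts t \<subseteq> W} \<le> \<beta>" if "W \<subseteq> ?U" "card W \<le> (n - 1) * card J" for W
      using that \<open>J \<in> ?\<J>\<close> by (intro few[of W "card J"]) auto
    show "J \<subseteq> {..<M}" using that by simp
  qed
  have B: "(M choose j) * ?B j \<le> (z * C) ^ j * card T ^ M" for j
  proof (cases "j \<le> M")
    case True
    \<comment> \<open>One power of \<open>N\<close> from the choice of an index and
      \<open>n - 1\<close> from the covering points make up the factor \<open>N ^ n\<close> of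
      \<open>card T\<close>.\<close>
    have "N * (card ?U ^ (n - 1) * \<beta>) = C * (card H * (N * N ^ (n - 1)))"
      by (simp add: C_def \<beta>_def n_def card_cartesian_product power_mult_distrib)
    also have "N * N ^ (n - 1) = N ^ n" using n by (metis Suc_diff_le diff_Suc_1 One_nat_def power_Suc Suc_pred' Suc_le_eq)
    finally have "(N * (card ?U ^ (n - 1) * \<beta>)) ^ j = (C * card T) ^ j" by (simp add: cardT)
    then have *: "N ^ j * (card ?U ^ ((n - 1) * j) * \<beta> ^ j) = C ^ j * card T ^ j"
      by (simp only: power_mult_distrib power_mult)
    have "(M choose j) * ?B j \<le> (z * N) ^ j * ?B j"
      using binomial_le_pow[OF True] by (simp add: M_def mult_right_mono)
    also have "\<dots> = z ^ j * (N ^ j * (card ?U ^ ((n - 1) * j) * \<beta> ^ j)) * card T ^ (M - j)"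
      by (simp only: power_mult_distrib mult.assoc)
    also have "\<dots> = (z * C) ^ j * (card T ^ j * card T ^ (M - j))"
      by (simp only: * power_mult_distrib mult.assoc)
    also have "card T ^ j * card T ^ (M - j) = card T ^ M"
      using True by (simp flip: power_add)
    finally show ?thesis .
  qed (simp add: binomial_eq_0)
  have fin\<J>: "finite ?\<J>" by (rule finite_subset[of _ "Pow {..<M}"]) auto
  have "(\<Sum>s\<in>?\<Omega>. card {J\<in>?\<J>. card (\<Union>i\<in>J. pts (s i)) \<le> (n - 1) * card J})
      = (\<Sum>J\<in>?\<J>. card {s\<in>?\<Omega>. card (\<Union>i\<in>J. pts (s i)) \<le> (n - 1) * card J})"
    by (rule sum_multicount_gen[OF fin\<Omega> fin\<J>]) simp
  also have "\<dots> \<le> (\<Sum>J\<in>?\<J>. ?B (card J))" by (intro sum_mono crowded)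
  also have "\<dots> = (\<Sum>j=1..g. \<Sum>J\<in>{J\<in>?\<J>. card J = j}. ?B (card J))"
    using fin\<J> by (intro sum.group[symmetric]) auto
  also have "\<dots> = (\<Sum>j=1..g. (M choose j) * ?B j)"
  proof (rule sum.cong[OF refl])
    fix j assume "j \<in> {1..g}"
    then have "{J\<in>?\<J>. card J = j} = {J. J \<subseteq> {..<M} \<and> card J = j}" by auto
    then show "(\<Sum>J\<in>{J\<in>?\<J>. card J = j}. ?B (card J)) = (M choose j) * ?B j"
      using n_subsets[of "{..<M}" j] by simp
  qed
  also have "\<dots> \<le> (\<Sum>j=1..g. (z * C) ^ j * card T ^ M)" by (intro sum_mono B)
  also have "\<dots> = (\<Sum>j=1..g. (z * C) ^ j) * card T ^ M" by (simp add: sum_distrib_right)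
  finally show ?thesis unfolding M_def n_def .
qed

text \<open>Erdos--Hajnal alteration: among \<open>z * N\<close> random lifts of hyperedges, every colouring
  sees more than \<open>N\<close> monochromatic ones, while the expected number of crowded sets of at most \<open>g\<close>
  hyperedges is bounded independently of \<open>N\<close>, so one hyperedge of each crowded set can be deleted.\<close>
lemma sparse_blow_up:
  fixes X :: "'x set" and V :: "'a set" and H :: "('a \<Rightarrow> 'x) set" and g k :: nat
  assumes V: "finite V" "V \<noteq> {}" and X: "finite X" and H: "finite H" "H \<subseteq> V \<rightarrow> X"
    and k: "k \<ge> 1"
    and ncol: "\<forall>\<chi> :: 'x \<Rightarrow> nat. (\<forall>x\<in>X. \<chi> x < k) \<longrightarrow> (\<exists>h\<in>H. monochromatic \<chi> h V)"
  obtains J :: "nat set" and s :: "nat \<Rightarrow> 'a \<Rightarrow> 'x \<times> nat" and N :: nat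
  where "finite J"
    and "\<forall>e\<in>J. \<exists>h\<in>H. \<forall>v\<in>V. fst (s e v) = h v \<and> snd (s e v) < N"
    and "\<forall>\<chi> :: 'x \<times> nat \<Rightarrow> nat. (\<forall>p\<in>X \<times> {..<N}. \<chi> p < k) \<longrightarrow> (\<exists>e\<in>J. monochromatic \<chi> (s e) V)"
    and "\<forall>F\<subseteq>J. F \<noteq> {} \<longrightarrow> card F \<le> g \<longrightarrow> (card V - 1) * card F < card (\<Union>e\<in>F. s e ` V)"
proof -
  have HX: "h v \<in> X" if "h \<in> H" "v \<in> V" for h v using H(2) that by auto
  obtain h0 where h0: "h0 \<in> H" using ncol[rule_format, of "\<lambda>_. 0"] k by auto
  have X': "X \<noteq> {}" using h0 HX V by blast
  have cardH: "card H \<ge> 1" using h0 H by (auto simp: Suc_le_eq card_gt_0_iff)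
  define D where "D = card H * k ^ card V"
  have D: "D \<ge> 1" using cardH k by (simp add: D_def)
  \<comment> \<open>For each colouring at least a share \<open>1 / D\<close> of the lifts is
    monochromatic, and a hit weighs 1/2, so an entry of \<open>s\<close> has average weight at most
    \<open>\<delta>\<close>.\<close>
  define \<delta> :: real where "\<delta> = 1 - 1 / (2 * D)"
  have \<delta>: "0 \<le> \<delta>" "\<delta> < 1" using D by (auto simp: \<delta>_def field_simps)
  \<comment> \<open>With \<open>z * N\<close> entries the decay beats the
    \<open>k ^ (card X * N)\<close> colourings and the Markov factor \<open>2 ^ N\<close>; all of
    these are \<open>N\<close>-th powers.\<close>
  obtain z where "\<delta> ^ z < 1 / (4 * k ^ card X)"
    using real_arch_pow_inv[of "1 / (4 * k ^ card X)" \<delta>] \<delta> k by auto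
  then have z: "2 * k ^ card X * \<delta> ^ z \<le> 1 / 2" using k by (simp add: field_simps)
  define C where "C = card X ^ (card V - 1) * (card V * g) ^ card V"
  define K where "K = (\<Sum>j=1..g. (z * C) ^ j)"
  \<comment> \<open>A multiple of \<open>k\<close>, as supersaturation requires, and more than twice
    the bound \<open>K\<close> on the average number of crowded sets; \<open>K\<close> does not
    depend on \<open>N\<close>.\<close>
  define N where "N = k * (2 * K + 1)"
  have "1 * (2 * K + 1) \<le> N" unfolding N_def using k by (intro mult_right_mono) auto
  then have N: "N \<ge> 1" "N > 2 * K" by auto
  define M where "M = z * N"
  define T where "T = H \<times> (V \<rightarrow>\<^sub>E {..<N})"
  define pts where "pts = (\<lambda>(h :: 'a \<Rightarrow> 'x, t :: 'a \<Rightarrow> nat). (\<lambda>v. (h v, t v)) ` V)"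
  have finT: "finite T" unfolding T_def using V H by (auto intro!: finite_PiE)
  have cardT: "card T \<ge> 1" using V N cardH by (simp add: T_def card_cartesian_product card_PiE)
  let ?\<Omega> = "{..<M} \<rightarrow>\<^sub>E T"
  have fin\<Omega>: "finite ?\<Omega>" using finT by (auto intro!: finite_PiE)
  have card\<Omega>: "card ?\<Omega> = card T ^ M" by (simp add: card_PiE)
  define bad where "bad s = {J \<in> {J. J \<subseteq> {..<M} \<and> card J \<in> {1..g}}.
      card (\<Union>i\<in>J. pts (s i)) \<le> (card V - 1) * card J}" for s
  have "(\<Sum>s\<in>?\<Omega>. card (bad s)) \<le> K * card ?\<Omega>"
    using few_crowded_on_average[OF V X X' H N(1), of z g] card\<Omega>
    unfolding bad_def M_def T_def pts_def K_def C_def by simp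
  then have "real (\<Sum>s\<in>?\<Omega>. card (bad s)) \<le> real (K * card ?\<Omega>)" by (simp only: of_nat_le_iff)
  then have "(\<Sum>s\<in>?\<Omega>. real (card (bad s)) / N) \<le> real K * real (card ?\<Omega>) / N"
    unfolding sum_divide_distrib[symmetric] by (intro divide_right_mono) auto
  also have "\<dots> < card ?\<Omega> / 2"
  proof -
    have "2 * real K < real N" using N(2) by linarith
    moreover have "real (card ?\<Omega>) > 0" unfolding card\<Omega> using cardT by simp
    ultimately show ?thesis using N(1) by (simp add: divide_less_eq)
  qed
  finally have avg_bad: "(\<Sum>s\<in>?\<Omega>. real (card (bad s)) / N) < card ?\<Omega> / 2" .

  let ?\<X> = "X \<times> {..<N} \<rightarrow>\<^sub>E {..<k}"
  define Mono where "Mono \<chi> = {(h, t) \<in> T. monochromatic \<chi> (\<lambda>v. (h v, t v)) V}" for \<chi> :: "'x \<times> nat \<Rightarrow> nat"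
  have Mono: "Mono \<chi> \<subseteq> T" for \<chi> unfolding Mono_def by auto
  have fin\<X>: "finite ?\<X>" using X by (auto intro!: finite_PiE)
  have card\<X>: "card ?\<X> = (k ^ card X) ^ N" using X by (simp add: card_PiE card_cartesian_product power_mult)
  have hits: "(\<Sum>s\<in>?\<Omega>. (1/2::real) ^ card {i\<in>{..<M}. s i \<in> Mono \<chi>}) \<le> (card T * \<delta>) ^ M"
    if "\<chi> \<in> ?\<X>" for \<chi>
  proof -
    have "card T \<le> D * card (Mono \<chi>)"
      using blow_up_supersaturation[OF V(1) H k ncol, where n = "2 * K + 1" and \<chi> = \<chi>] that
      unfolding D_def Mono_def T_def N_def by (auto simp: PiE_iff)
    then have "real (card T) \<le> D * card (Mono \<chi>)" by (metis of_nat_le_iff of_nat_mult)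
    then have "real (card T) - card (Mono \<chi>) / 2 \<le> card T * \<delta>"
      using D by (simp add: \<delta>_def field_simps)
    moreover have "0 \<le> real (card T) - card (Mono \<chi>) / 2"
      using card_mono[OF finT Mono, of \<chi>] by simp
    ultimately show ?thesis
      unfolding sum_half_power_hits[OF finT Mono] by (rule power_mono)
  qed
  \<comment> \<open>A colouring with at most \<open>N\<close> hits contributes at least 1 to the
    inner sum, so an inner sum below 1 rules out all such colourings.\<close>
  have "(\<Sum>s\<in>?\<Omega>. \<Sum>\<chi>\<in>?\<X>. 2 ^ N * (1/2::real) ^ card {i\<in>{..<M}. s i \<in> Mono \<chi>})
      = 2 ^ N * (\<Sum>\<chi>\<in>?\<X>. \<Sum>s\<in>?\<Omega>. (1/2::real) ^ card {i\<in>{..<M}. s i \<in> Mono \<chi>})"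
    by (subst sum.swap) (simp add: sum_distrib_left)
  also have "\<dots> \<le> 2 ^ N * (\<Sum>\<chi>\<in>?\<X>. (card T * \<delta>) ^ M)"
    by (intro mult_left_mono sum_mono hits) auto
  also have "\<dots> = card ?\<Omega> * (2 * k ^ card X * \<delta> ^ z) ^ N"
    unfolding sum_constant card\<X> card\<Omega> by (simp add: M_def power_mult_distrib power_mult)
  also have "\<dots> \<le> card ?\<Omega> * (1 / 2) ^ N"
    using z \<delta> by (intro mult_left_mono power_mono) auto
  also have "\<dots> \<le> card ?\<Omega> / 2"
    using mult_left_mono[OF power_decreasing[OF N(1), of "1/2::real"], of "card ?\<Omega>"] by simp
  finally have avg_hits: "(\<Sum>s\<in>?\<Omega>. \<Sum>\<chi>\<in>?\<X>. 2 ^ N * (1/2::real) ^ card {i\<in>{..<M}. s i \<in> Mono \<chi>}) \<le> card ?\<Omega> / 2" .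

  \<comment> \<open>The two averages add up to less than 1, so a single \<open>s\<close> has few
    crowded sets and many hits for every colouring.\<close>
  obtain s where s: "s \<in> ?\<Omega>"
    and small: "(\<Sum>\<chi>\<in>?\<X>. 2 ^ N * (1/2::real) ^ card {i\<in>{..<M}. s i \<in> Mono \<chi>}) + real (card (bad s)) / N < 1"
    by (rule exists_below_average[OF fin\<Omega>, of "\<lambda>s. (\<Sum>\<chi>\<in>?\<X>. 2 ^ N * (1/2::real) ^ card {i\<in>{..<M}. s i \<in> Mono \<chi>}) + real (card (bad s)) / N"])
      (use avg_bad avg_hits in \<open>auto simp: sum.distrib\<close>)
  have nonneg: "0 \<le> (\<Sum>\<chi>\<in>?\<X>. 2 ^ N * (1/2::real) ^ card {i\<in>{..<M}. s i \<in> Mono \<chi>})"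
    by (intro sum_nonneg) auto
  have "real (card (bad s)) / N < 1" using small nonneg by linarith
  then have few_bad: "card (bad s) < N" using N(1) by (simp add: divide_less_eq)
  have many_hits: "N < card {i\<in>{..<M}. s i \<in> Mono \<chi>}" if "\<chi> \<in> ?\<X>" for \<chi>
  proof -
    have "2 ^ N * (1/2::real) ^ card {i\<in>{..<M}. s i \<in> Mono \<chi>}
        \<le> (\<Sum>\<chi>\<in>?\<X>. 2 ^ N * (1/2::real) ^ card {i\<in>{..<M}. s i \<in> Mono \<chi>})"
      using fin\<X> that by (intro member_le_sum) auto
    also have "\<dots> < 1"
    proof -
      have "0 \<le> real (card (bad s)) / N" by simp
      then show ?thesis using small by linarith
    qed
    finally have "(2::real) ^ N < 2 ^ card {i\<in>{..<M}. s i \<in> Mono \<chi>}"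
      by (simp add: power_one_over field_simps)
    then show ?thesis by simp
  qed

  \<comment> \<open>One index of every crowded set is removed. Fewer than \<open>N\<close> are lost
    while each colouring has more than \<open>N\<close> hits, so a monochromatic lift
    survives.\<close>
  define R where "R = (\<lambda>F. SOME i. i \<in> F) ` bad s"
  have finbad: "finite (bad s)" unfolding bad_def by (rule finite_subset[of _ "Pow {..<M}"]) auto
  have R: "finite R" "card R < N"
    unfolding R_def using finbad card_image_le[OF finbad] few_bad by (auto intro: le_less_trans)
  show ?thesis
  proof (rule that[of "{..<M} - R" "\<lambda>e v. (fst (s e) v, snd (s e) v)" N]; (intro ballI allI impI)?)
    show "finite ({..<M} - R)" by simp
    show "\<exists>h\<in>H. \<forall>v\<in>V. fst (fst (s e) v, snd (s e) v) = h v \<and> snd (fst (s e) v, snd (s e) v) < N"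
      if "e \<in> {..<M} - R" for e
    proof -
      have "s e \<in> T" using s that by auto
      then show ?thesis unfolding T_def by (auto simp: mem_Times_iff PiE_iff)
    qed
    show "\<exists>e\<in>{..<M} - R. monochromatic \<chi> (\<lambda>v. (fst (s e) v, snd (s e) v)) V"
      if "\<forall>p\<in>X \<times> {..<N}. \<chi> p < k" for \<chi> :: "'x \<times> nat \<Rightarrow> nat"
    proof -
      \<comment> \<open>\<open>many_hits\<close> concerns extensional colourings; the lifts only use
        points of \<open>X \<times> {..<N}\<close>, where \<open>?\<chi>\<close> and
        \<open>\<chi>\<close> agree.\<close>
      let ?\<chi> = "restrict \<chi> (X \<times> {..<N})"
      have "?\<chi> \<in> ?\<X>" using that by (auto simp: PiE_iff)
      from many_hits[OF this] R have "card R < card {i\<in>{..<M}. s i \<in> Mono ?\<chi>}" by simp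
      then have "\<not> {i\<in>{..<M}. s i \<in> Mono ?\<chi>} \<subseteq> R"
        using card_mono[OF R(1)] by (meson not_le)
      then obtain i where i: "i \<in> {..<M} - R" "s i \<in> Mono ?\<chi>" by blast
      then have "monochromatic ?\<chi> (\<lambda>v. (fst (s i) v, snd (s i) v)) V" "s i \<in> T"
        unfolding Mono_def by auto
      then have "monochromatic \<chi> (\<lambda>v. (fst (s i) v, snd (s i) v)) V"
        using HX unfolding monochromatic_def T_def by (auto simp: PiE_iff mem_Times_iff)
      then show ?thesis using i by blast
    qed
    show "(card V - 1) * card F < card (\<Union>e\<in>F. (\<lambda>v. (fst (s e) v, snd (s e) v)) ` V)"
      if F: "F \<subseteq> {..<M} - R" "F \<noteq> {}" "card F \<le> g" for F
    proof (rule ccontr)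
      assume "\<not> ?thesis"
      moreover have "pts (s e) = (\<lambda>v. (fst (s e) v, snd (s e) v)) ` V" for e
        by (simp add: pts_def case_prod_beta)
      moreover have "card F \<ge> 1" using F finite_subset[OF F(1)] by (auto simp: Suc_le_eq card_gt_0_iff)
      ultimately have "F \<in> bad s" using F unfolding bad_def by auto
      then have "(SOME i. i \<in> F) \<in> R" unfolding R_def by blast
      moreover have "(SOME i. i \<in> F) \<in> F" using F(2) by (simp add: some_in_eq)
      ultimately show False using F(1) by blast
    qed
  qed
qed

section \<open>Edge labellings by coordinate directions\<close>

text \<open>\<open>\<lambda>x c. L c x\<close> maps the graph to a Hamming graph, every edge changing exactly one coordinate,
  and distinct edges at a vertex changing distinct coordinates.\<close>
definition axis_labelling :: "('v \<Rightarrow> 'v \<Rightarrow> bool) \<Rightarrow> ('c \<Rightarrow> 'v \<Rightarrow> 'l) \<Rightarrow> bool" where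
  "axis_labelling E L \<longleftrightarrow> (\<forall>x y. E x y \<longrightarrow> (\<exists>!c. L c x \<noteq> L c y)) \<and>
     (\<forall>x y z c. E x y \<longrightarrow> E x z \<longrightarrow> L c x \<noteq> L c y \<longrightarrow> L c x \<noteq> L c z \<longrightarrow> y = z)"

text \<open>An edge is an unordered pair, hence the quantified endpoints; on an edge of an
  axis-labelled graph exactly one coordinate qualifies.\<close>

definition axis :: "('c \<Rightarrow> 'v \<Rightarrow> 'l) \<Rightarrow> 'v set \<Rightarrow> 'c" where
  "axis L e = (THE c. \<exists>x y. e = {x, y} \<and> L c x \<noteq> L c y)"

lemma axis_eq_iff:
  assumes "axis_labelling E L" "E x y"
  shows "axis L {x, y} = c \<longleftrightarrow> L c x \<noteq> L c y"
proof -
  obtain d where d: "\<And>c. L c x \<noteq> L c y \<longleftrightarrow> c = d"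
    using assms unfolding axis_labelling_def by blast
  have "(\<exists>u v. {x, y} = {u, v} \<and> L c u \<noteq> L c v) \<longleftrightarrow> c = d" for c
    using d[of c] by (auto simp: doubleton_eq_iff)
  then have "axis L {x, y} = d" by (simp add: axis_def)
  then show ?thesis using d[of c] by auto
qed

lemma axis_proper:
  assumes "simple_graph V E" "axis_labelling E L"
  shows "proper_edge_colouring V E (axis L)"
  unfolding proper_edge_colouring_def
proof (intro ballI impI notI)
  fix e f assume e: "e \<in> edges V E" and f: "f \<in> edges V E"
    and ef: "e \<noteq> f \<and> e \<inter> f \<noteq> {}" and col: "axis L e = axis L f"
  from ef obtain x where x: "x \<in> e" "x \<in> f" by blast
  have "\<exists>y. e = {x, y} \<and> E x y" if "x \<in> e" "e \<in> edges V E" for e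
    using that assms(1) unfolding edges_def simple_graph_def by (auto simp: doubleton_eq_iff)
  then obtain y z where y: "e = {x, y}" "E x y" and z: "f = {x, z}" "E x z"
    using x e f by meson
  have "L (axis L e) x \<noteq> L (axis L e) y" "L (axis L e) x \<noteq> L (axis L e) z"
    using axis_eq_iff[OF assms(2) y(2), of "axis L e"] axis_eq_iff[OF assms(2) z(2), of "axis L e"]
      col y(1) z(1) by simp_all
  then have "y = z" using assms(2) y(2) z(2) unfolding axis_labelling_def by blast
  then show False using ef y z by simp
qed

section \<open>Walking around cycles and the colours met on the way\<close>

text \<open>Periodic extension of the cycle to all natural indices, so that a walk needs no case
  split where it wraps around.\<close>

definition cyc :: "'a list \<Rightarrow> nat \<Rightarrow> 'a" where
  "cyc cs i = cs ! (i mod length cs)"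

lemma cyc_step: "is_cycle V E cs \<Longrightarrow> E (cyc cs i) (cyc cs (Suc i))"
  unfolding is_cycle_def cyc_def
  by (metis Suc_eq_plus1 mod_Suc_eq mod_less_divisor numeral_3_eq_3 Suc_le_lessD less_le_trans zero_less_Suc)

lemma cyc_eq_iff:
  assumes "is_cycle V E cs"
  shows "cyc cs i = cyc cs j \<longleftrightarrow> i mod length cs = j mod length cs"
proof -
  have "length cs > 0" "distinct cs" using assms by (auto simp: is_cycle_def)
  then show ?thesis unfolding cyc_def by (simp add: nth_eq_iff_index_eq)
qed

lemma cyc_add_length [simp]: "cyc cs (i + length cs) = cyc cs i"
  by (simp add: cyc_def)

lemma cyc_add_neq:
  assumes "is_cycle V E cs" "0 < d" "d < length cs"
  shows "cyc cs (i + d) \<noteq> cyc cs i"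
proof
  assume "cyc cs (i + d) = cyc cs i"
  then have "(i + d) mod length cs = i mod length cs" using cyc_eq_iff[OF assms(1)] by blast
  then have "length cs dvd i + d - i" by (subst (asm) mod_eq_dvd_iff_nat) auto
  then show False using assms by (auto dest: dvd_imp_le)
qed

lemma range_cyc:
  assumes "is_cycle V E cs"
  shows "range (cyc cs) = set cs"
proof -
  have "length cs > 0" using assms by (auto simp: is_cycle_def)
  then have "cyc cs i \<in> set cs" for i by (simp add: cyc_def)
  moreover have "x \<in> range (cyc cs)" if "x \<in> set cs" for x
    using that unfolding in_set_conv_nth cyc_def by (metis mod_less rangeI)
  ultimately show ?thesis by blast
qed

text \<open>Passing the property forward also reaches the indices before \<open>a\<close>, after
  adding \<open>a\<close> full turns.\<close>

lemma cyc_invariant: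
  assumes cs: "is_cycle V E cs" and step: "\<And>i. P (cyc cs i) \<Longrightarrow> P (cyc cs (Suc i))" and base: "P (cyc cs a)"
  shows "P (cyc cs i)"
proof -
  have *: "P (cyc cs (a + d))" for d using step base by (induction d) auto
  have "length cs > 0" using cs by (auto simp: is_cycle_def)
  then have "a * 1 \<le> a * length cs" by (intro mult_left_mono) (simp_all add: Suc_le_eq)
  then have "a \<le> i + a * length cs" unfolding mult_1_right by (rule trans_le_add2)
  then have "P (cyc cs (i + a * length cs))" using *[of "i + a * length cs - a"] by simp
  then show ?thesis by (simp add: cyc_def)
qed

text \<open>If only \<open>e0\<close> changed the coordinate \<open>c\<close>, walking from one end
  of \<open>e0\<close> to the other along the rest of the cycle would keep \<open>L c\<close>
  constant, yet its two ends differ in \<open>c\<close>.\<close>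

lemma axis_no_colour_once:
  assumes L: "axis_labelling E L"
  shows "no_colour_once_on_cycles V E (axis L)"
  unfolding no_colour_once_on_cycles_def
proof (intro allI impI notI)
  fix cs c assume cs: "is_cycle V E cs" and one: "card {e \<in> cycle_edges cs. axis L e = c} = 1"
  let ?f = "cyc cs"
  have len: "length cs \<ge> 3" using cs by (simp add: is_cycle_def)
  have edges: "cycle_edges cs = range (\<lambda>i. {?f i, ?f (Suc i)})"
  proof -
    have "{?f i, ?f (Suc i)} \<in> cycle_edges cs" for i
    proof -
      have "i mod length cs < length cs" using len by (intro mod_less_divisor) linarith
      then show ?thesis
        unfolding cycle_edges_def cyc_def by (auto intro!: exI[of _ "i mod length cs"] simp: mod_Suc_eq)
    qed
    moreover have "e \<in> range (\<lambda>i. {?f i, ?f (Suc i)})" if "e \<in> cycle_edges cs" for e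
      using that unfolding cycle_edges_def cyc_def by (auto intro!: rev_image_eqI)
    ultimately show ?thesis by blast
  qed
  obtain e0 where e0: "{e \<in> cycle_edges cs. axis L e = c} = {e0}" using one by (auto simp: card_1_singleton_iff)
  have "e0 \<in> {e \<in> cycle_edges cs. axis L e = c}" unfolding e0 by simp
  then have "e0 \<in> range (\<lambda>i. {?f i, ?f (Suc i)})" "axis L e0 = c" unfolding edges by simp_all
  then obtain p where p: "e0 = {?f p, ?f (Suc p)}" by auto
  have change: "L c (?f i) \<noteq> L c (?f (Suc i)) \<longleftrightarrow> {?f i, ?f (Suc i)} = e0" for i
  proof -
    have "{?f i, ?f (Suc i)} \<in> cycle_edges cs" unfolding edges by (rule rangeI)
    then have "axis L {?f i, ?f (Suc i)} = c \<longleftrightarrow> {?f i, ?f (Suc i)} \<in> {e \<in> cycle_edges cs. axis L e = c}"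
      by simp
    then show ?thesis unfolding e0 axis_eq_iff[OF L cyc_step[OF cs]] by simp
  qed
  have "L c (?f (Suc p + d)) = L c (?f (Suc p))" if "d \<le> length cs - 1" for d
    using that
  proof (induction d)
    case (Suc d)
    have "?f (Suc p + d) \<noteq> ?f p" using cyc_add_neq[OF cs, of "Suc d" p] Suc.prems by simp
    \<comment> \<open>The edge \<open>e0\<close> is not traversed backwards either; for
      \<open>d = 0\<close> this uses that the cycle has at least three vertices.\<close>
    moreover have "?f (Suc p + d) \<noteq> ?f (Suc p) \<or> ?f (Suc (Suc p + d)) \<noteq> ?f p"
    proof (cases "d = 0")
      case True
      then show ?thesis using cyc_add_neq[OF cs, of 2 p] len by (simp add: numeral_2_eq_2)
    next
      case False
      then show ?thesis using cyc_add_neq[OF cs, of d "Suc p"] Suc.prems by simp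
    qed
    ultimately have "{?f (Suc p + d), ?f (Suc (Suc p + d))} \<noteq> e0"
      unfolding p by (auto simp: doubleton_eq_iff)
    then have "L c (?f (Suc p + d)) = L c (?f (Suc (Suc p + d)))" using change by blast
    then show ?case using Suc by simp
  qed simp
  from this[of "length cs - 1"] have "L c (?f (Suc p + (length cs - 1))) = L c (?f (Suc p))" by simp
  moreover have "Suc p + (length cs - 1) = p + length cs" using len by simp
  ultimately have "L c (?f p) = L c (?f (Suc p))" by (simp only: cyc_add_length)
  then show False using change[of p] p by simp
qed

section \<open>The construction\<close>

text \<open>\<open>Inl p\<close> is a vertex of the hypergraph and \<open>Inr (e, i)\<close> is the vertex \<open>i\<close> in the copy of the
  graph belonging to the hyperedge \<open>e\<close>, whose \<open>i\<close>-th point is \<open>s e i\<close>.\<close>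
fun tutte_adj :: "('a \<Rightarrow> 'a \<Rightarrow> bool) \<Rightarrow> 'a set \<Rightarrow> 'e set \<Rightarrow> ('e \<Rightarrow> 'a \<Rightarrow> 'p) \<Rightarrow>
    'p + 'e \<times> 'a \<Rightarrow> 'p + 'e \<times> 'a \<Rightarrow> bool" where
  "tutte_adj E V J s (Inr (e, i)) (Inr (f, j)) \<longleftrightarrow> e \<in> J \<and> e = f \<and> E i j"
| "tutte_adj E V J s (Inl p) (Inr (e, i)) \<longleftrightarrow> e \<in> J \<and> i \<in> V \<and> p = s e i"
| "tutte_adj E V J s (Inr (e, i)) (Inl p) \<longleftrightarrow> e \<in> J \<and> i \<in> V \<and> p = s e i"
| "tutte_adj E V J s (Inl p) (Inl q) \<longleftrightarrow> False"

lemma tutte_simple_graph: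
  assumes "simple_graph V E" "finite P" "finite J" "\<And>e i. e \<in> J \<Longrightarrow> i \<in> V \<Longrightarrow> s e i \<in> P"
  shows "simple_graph (Inl ` P \<union> Inr ` (J \<times> V)) (tutte_adj E V J s)"
  unfolding simple_graph_def
proof (intro conjI allI impI)
  show "finite (Inl ` P \<union> Inr ` (J \<times> V))" using assms by (auto simp: simple_graph_def)
  show "tutte_adj E V J s y x" if "tutte_adj E V J s x y" for x y
    using that assms(1) by (cases x; cases y) (auto simp: simple_graph_def)
  show "\<not> tutte_adj E V J s x x" for x
    using assms(1) by (cases x) (auto simp: simple_graph_def)
  show "x \<in> Inl ` P \<union> Inr ` (J \<times> V)" "y \<in> Inl ` P \<union> Inr ` (J \<times> V)"
    if "tutte_adj E V J s x y" for x y
    using that assms by (cases x; cases y; force simp: simple_graph_def)+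
qed

lemma tutte_not_colourable:
  assumes ncol: "\<nexists>c. proper_vertex_colouring V E c k"
    and mono: "\<And>\<chi> :: 'p \<Rightarrow> nat. (\<forall>p\<in>P. \<chi> p < Suc k) \<Longrightarrow> \<exists>e\<in>J. monochromatic \<chi> (s e) V"
    and sP: "\<And>e i. e \<in> J \<Longrightarrow> i \<in> V \<Longrightarrow> s e i \<in> P"
    and E: "simple_graph V E"
  shows "\<nexists>c. proper_vertex_colouring (Inl ` P \<union> Inr ` (J \<times> V)) (tutte_adj E V J s) c (Suc k)"
proof
  assume "\<exists>c. proper_vertex_colouring (Inl ` P \<union> Inr ` (J \<times> V)) (tutte_adj E V J s) c (Suc k)"
  then obtain c where
      c: "proper_vertex_colouring (Inl ` P \<union> Inr ` (J \<times> V)) (tutte_adj E V J s) c (Suc k)"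
    by (rule exE)
  have bound: "c x < Suc k" if "x \<in> Inl ` P \<union> Inr ` (J \<times> V)" for x
    using c that unfolding proper_vertex_colouring_def by blast
  have proper: "c x \<noteq> c y" if "tutte_adj E V J s x y" for x y
    using c that by (simp add: proper_vertex_colouring_def)
  have "\<forall>p\<in>P. c (Inl p) < Suc k" using bound by simp
  then have "\<exists>e\<in>J. monochromatic (\<lambda>p. c (Inl p)) (s e) V" by (rule mono)
  then obtain e c0 where e: "e \<in> J" "\<forall>i\<in>V. c (Inl (s e i)) = c0"
    unfolding monochromatic_def by blast
  \<comment> \<open>The copy avoids \<open>c0\<close>, so the top colour \<open>k\<close> can be
    renamed to \<open>c0\<close>; if \<open>c0 = k\<close>, nothing in the copy is renamed.\<close>
  define c' where "c' i = (if c (Inr (e, i)) = k then c0 else c (Inr (e, i)))" for i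
  have miss: "c (Inr (e, i)) \<noteq> c0" if "i \<in> V" for i
    using proper[of "Inl (s e i)" "Inr (e, i)"] e that by simp
  have "proper_vertex_colouring V E c' k"
    unfolding proper_vertex_colouring_def
  proof (intro conjI ballI allI impI)
    fix i assume i: "i \<in> V"
    have "c0 < Suc k" using bound[of "Inl (s e i)"] e(2) i sP[OF e(1) i] by simp
    moreover have "c (Inr (e, i)) < Suc k" using bound[of "Inr (e, i)"] e(1) i by simp
    ultimately show "c' i < k" using miss[OF i] by (auto simp: c'_def)
  next
    fix i j assume ij: "E i j"
    then have "i \<in> V" "j \<in> V" using E by (auto simp: simple_graph_def)
    then show "c' i \<noteq> c' j"
      using miss[of i] miss[of j] proper[of "Inr (e, i)" "Inr (e, j)"] e(1) ij by (auto simp: c'_def)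
  qed
  then show False using ncol by blast
qed

text \<open>An old coordinate is applied letter by letter to the word underlying a point; since the points
  of a hyperedge form a combinatorial line, it separates two of them iff it separates their letters.
  The coordinate \<open>Inr e\<close> is new and separates copy \<open>e\<close> from everything else.\<close>
fun tutte_label :: "('c \<Rightarrow> 'a \<Rightarrow> nat) \<Rightarrow> ('e \<Rightarrow> 'a \<Rightarrow> 'a list \<times> nat) \<Rightarrow>
    'c + 'e \<Rightarrow> ('a list \<times> nat) + 'e \<times> 'a \<Rightarrow> nat list" where
  "tutte_label L s (Inl c) (Inl p) = map (L c) (fst p)"
| "tutte_label L s (Inl c) (Inr (e, i)) = map (L c) (fst (s e i))"
| "tutte_label L s (Inr f) (Inl p) = []"
| "tutte_label L s (Inr f) (Inr (e, i)) = (if e = f then [0] else [])"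

text \<open>Fixed positions always agree, and an active one carries the letters \<open>i\<close> and
  \<open>j\<close> themselves.\<close>

lemma map_inst_eq_iff:
  "None \<in> set l \<Longrightarrow> map f (inst l i) = map f (inst l j) \<longleftrightarrow> f i = f j"
  by (force simp: inst_def split: option.splits)

text \<open>Edges inside a copy change the same old coordinate as before, matching edges only the
  new one of their copy. At a point, injectivity of \<open>s e\<close> leaves one matching edge per
  copy; a vertex of a copy has just one.\<close>

lemma tutte_axis_labelling:
  assumes L: "axis_labelling E L" and E: "simple_graph V E"
    and s: "\<And>e. e \<in> J \<Longrightarrow> \<exists>l\<in>templates V M. \<forall>i\<in>V. fst (s e i) = inst l i"
    and inj: "\<And>e. e \<in> J \<Longrightarrow> inj_on (s e) V"
  shows "axis_labelling (tutte_adj E V J s) (tutte_label L s)"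
proof -
  let ?E = "tutte_adj E V J s" and ?L = "tutte_label L s"
  have V: "i \<in> V" "j \<in> V" if "E i j" for i j using that E by (auto simp: simple_graph_def)
  have copy: "?L c (Inr (e, i)) \<noteq> ?L c (Inr (e, j)) \<longleftrightarrow> (\<exists>d. c = Inl d \<and> L d i \<noteq> L d j)"
    if ij: "e \<in> J" "E i j" for c e i j
  proof -
    obtain l where l: "l \<in> templates V M" "fst (s e i) = inst l i" "fst (s e j) = inst l j"
      using s[OF ij(1)] V[OF ij(2)] by blast
    then have "None \<in> set l" by (simp add: templates_def)
    with l show ?thesis by (cases c) (auto simp: map_inst_eq_iff)
  qed
  have up: "?L c (Inl (s e i)) \<noteq> ?L c (Inr (e, i)) \<longleftrightarrow> c = Inr e" for c e i
    by (cases c) auto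
  have E_cases: "(\<exists>e i j. e \<in> J \<and> E i j \<and> x = Inr (e, i) \<and> y = Inr (e, j)) \<or>
      (\<exists>e i. e \<in> J \<and> i \<in> V \<and> x = Inl (s e i) \<and> y = Inr (e, i)) \<or>
      (\<exists>e i. e \<in> J \<and> i \<in> V \<and> x = Inr (e, i) \<and> y = Inl (s e i))" if "?E x y" for x y
    using that by (cases x; cases y) auto
  show ?thesis
    unfolding axis_labelling_def
  proof (intro conjI allI impI)
    fix x y assume "?E x y"
    from E_cases[OF this] show "\<exists>!c. ?L c x \<noteq> ?L c y"
    proof (elim disjE exE conjE)
      fix e i j assume *: "e \<in> J" "E i j" "x = Inr (e, i)" "y = Inr (e, j)"
      obtain d where "\<And>d'. L d' i \<noteq> L d' j \<longleftrightarrow> d' = d"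
        using L *(2) unfolding axis_labelling_def by blast
      then show ?thesis
        unfolding *(3,4) copy[OF *(1,2)] by (intro ex1I[of _ "Inl d"]) auto
    next
      fix e i assume *: "x = Inl (s e i)" "y = Inr (e, i)"
      show ?thesis unfolding * up by simp
    next
      fix e i assume *: "x = Inr (e, i)" "y = Inl (s e i)"
      show ?thesis unfolding * eq_commute[of "?L _ (Inr (e, i))"] up by simp
    qed
  next
    fix x y z c assume xy: "?E x y" and xz: "?E x z" and c: "?L c x \<noteq> ?L c y" "?L c x \<noteq> ?L c z"
    show "y = z"
    proof (cases x)
      case (Inl p)
      have nbr: "\<exists>e i. y = Inr (e, i) \<and> e \<in> J \<and> i \<in> V \<and> p = s e i \<and> c = Inr e"
        if "?E x y" "?L c x \<noteq> ?L c y" for y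
        using that Inl by (cases y; cases c) (auto split: if_splits)
      obtain e i where y: "y = Inr (e, i)" "e \<in> J" "i \<in> V" "p = s e i" "c = Inr e"
        using nbr[OF xy c(1)] by blast
      obtain f j where z: "z = Inr (f, j)" "f \<in> J" "j \<in> V" "p = s f j" "c = Inr f"
        using nbr[OF xz c(2)] by blast
      show ?thesis using y z inj_onD[OF inj[OF y(2)], of i j] by simp
    next
      case (Inr q)
      then obtain e i where x: "x = Inr (e, i)" by (cases q) auto
      have nbr: "(\<exists>j. e \<in> J \<and> E i j \<and> y = Inr (e, j)) \<or> e \<in> J \<and> y = Inl (s e i)" if "?E x y" for y
        using that x by (cases y) auto
      show ?thesis
      proof (cases c)
        case (Inl d)
        have "\<exists>j. E i j \<and> y = Inr (e, j) \<and> L d i \<noteq> L d j" if "?E x y" "?L c x \<noteq> ?L c y" for y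
          using nbr[OF that(1)] that(2) copy[of e i _ c] up[of c e i] x Inl by auto
        from this[OF xy c(1)] this[OF xz c(2)] show ?thesis
          using L unfolding axis_labelling_def by metis
      next
        case (Inr f)
        have "y = Inl (s e i)" if "?E x y" "?L c x \<noteq> ?L c y" for y
          using nbr[OF that(1)] that(2) copy[of e i _ c] x Inr by auto
        from this[OF xy c(1)] this[OF xz c(2)] show ?thesis by simp
      qed
    qed
  qed
qed

text \<open>A cycle leaving a copy meets a set \<open>F\<close> of copies and a set \<open>Y\<close> of at least \<open>card F\<close> points, each
  lying on two members of \<open>F\<close>, so the hyperedges in \<open>F\<close> cover at most \<open>(card V - 1) * card F\<close> points.\<close>
lemma tutte_girth:
  fixes s :: "'e \<Rightarrow> 'a \<Rightarrow> 'p"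
  assumes girth: "girth_at_least V E g" and V: "finite V" "V \<noteq> {}"
    and inj: "\<And>e. e \<in> J \<Longrightarrow> inj_on (s e) V"
    and sparse: "\<And>F. F \<subseteq> J \<Longrightarrow> F \<noteq> {} \<Longrightarrow> card F \<le> g \<Longrightarrow> (card V - 1) * card F < card (\<Union>e\<in>F. s e ` V)"
  shows "girth_at_least (Inl ` P \<union> Inr ` (J \<times> V)) (tutte_adj E V J s) g"
  unfolding girth_at_least_def
proof (intro allI impI)
  let ?E = "tutte_adj E V J s"
  fix cs assume cs: "is_cycle (Inl ` P \<union> Inr ` (J \<times> V)) ?E cs"
  define m where "m = length cs"
  have m: "m \<ge> 3" and dist: "distinct cs" and sub: "set cs \<subseteq> Inl ` P \<union> Inr ` (J \<times> V)"
    using cs by (auto simp: is_cycle_def m_def)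
  let ?f = "cyc cs"
  have range: "range ?f = set cs" using range_cyc[OF cs] .
  show "g \<le> length cs"
  proof (cases "\<exists>p. Inl p \<in> set cs")
    case False
    \<comment> \<open>Without points the cycle cannot change copies, so it projects to a cycle of
      the original graph.\<close>
    obtain e i0 where e: "?f 0 = Inr (e, i0)"
      using False range by (metis rangeI surj_pair sum.exhaust)
    have "\<exists>i. ?f k = Inr (e, i)" for k
    proof (rule cyc_invariant[OF cs, where P = "\<lambda>v. \<exists>i. v = Inr (e, i)" and a = 0])
      fix k assume "\<exists>i. ?f k = Inr (e, i)"
      then show "\<exists>i. ?f (Suc k) = Inr (e, i)"
        using cyc_step[OF cs, of k] False range by (cases "?f (Suc k)") (auto, metis rangeI)
    qed (use e in auto)
    then have all: "\<exists>i. v = Inr (e, i)" if "v \<in> set cs" for v using that range by (metis imageE)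
    define pr where "pr v = snd (projr v)" for v :: "'p + 'e \<times> 'a"
    have pr: "Inr (e, pr v) = v" if "v \<in> set cs" for v using all[OF that] by (auto simp: pr_def)
    have "is_cycle V E (map pr cs)"
      unfolding is_cycle_def
    proof (intro conjI allI impI)
      show "3 \<le> length (map pr cs)" using m by (simp add: m_def)
      show "distinct (map pr cs)" using dist unfolding distinct_map by (metis pr inj_onI)
      show "set (map pr cs) \<subseteq> V"
      proof
        fix i assume "i \<in> set (map pr cs)"
        then obtain v where "v \<in> set cs" "i = pr v" by auto
        then have "Inr (e, i) \<in> Inl ` P \<union> Inr ` (J \<times> V)" using pr sub by auto
        then show "i \<in> V" by auto
      qed
      fix k assume "k < length (map pr cs)"
      then have "k < length cs" by simp
      moreover from this have "(k + 1) mod length cs < length cs" by (intro mod_less_divisor) linarith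
      ultimately have k: "k < length cs" "(k + 1) mod length cs < length cs" .
      then have "?E (cs ! k) (cs ! ((k + 1) mod length cs))" using cs by (simp add: is_cycle_def)
      then have "?E (Inr (e, pr (cs ! k))) (Inr (e, pr (cs ! ((k + 1) mod length cs))))"
        using pr[OF nth_mem[OF k(1)]] pr[OF nth_mem[OF k(2)]] by simp
      then show "E (map pr cs ! k) (map pr cs ! ((k + 1) mod length (map pr cs)))" using k by simp
    qed
    then show ?thesis using girth unfolding girth_at_least_def by fastforce
  next
    case True
    show ?thesis
    proof (rule ccontr)
      assume short: "\<not> g \<le> length cs"
      define F where "F = {e. \<exists>i. Inr (e, i) \<in> set cs}"
      define Y where "Y = {p. Inl p \<in> set cs}"
      have nbr_Inl: "\<exists>e i. e \<in> J \<and> i \<in> V \<and> v = Inr (e, i) \<and> p = s e i"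
        if "?E v (Inl p) \<or> ?E (Inl p) v" for v p
        using that by (cases v) auto
      have FJ: "F \<subseteq> J" using sub unfolding F_def by auto
      have finF: "finite F"
      proof (rule finite_surj[of "set cs" _ "\<lambda>v. fst (projr v)"])
        show "F \<subseteq> (\<lambda>v. fst (projr v)) ` set cs" unfolding F_def by force
      qed simp
      have finY: "finite Y" unfolding Y_def by (rule finite_vimageI[of "set cs" Inl, unfolded vimage_def]) auto
      have "card Y = card (Inl ` Y :: ('p + 'e \<times> 'a) set)" by (simp add: card_image)
      also have "\<dots> \<le> card (set cs)" by (intro card_mono) (auto simp: Y_def)
      also have "\<dots> \<le> length cs" by (rule card_length)
      finally have Ylen: "card Y \<le> length cs" .
      \<comment> \<open>The two neighbours of a point on the cycle are distinct vertices, and they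
        lie in different copies because \<open>s e\<close> is injective.\<close>
      have two: "\<exists>e e'. e \<noteq> e' \<and> e \<in> F \<and> e' \<in> F \<and> p \<in> s e ` V \<and> p \<in> s e' ` V" if p: "p \<in> Y" for p
      proof -
        have "Inl p \<in> range ?f" using p unfolding range Y_def by simp
        then obtain a where a: "?f a = Inl p" by (metis imageE)
        obtain e i where e: "e \<in> J" "i \<in> V" "?f (Suc a) = Inr (e, i)" "p = s e i"
          using nbr_Inl cyc_step[OF cs, of a] a by metis
        \<comment> \<open>Modulo \<open>m\<close>, the index \<open>a + (m - 1)\<close> is the
          predecessor of \<open>a\<close>.\<close>
        have "Suc (a + (m - 1)) = a + length cs" using m by (simp add: m_def)
        then have "?f (Suc (a + (m - 1))) = Inl p" using a by (simp only: cyc_add_length)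
        then obtain e' i' where e': "e' \<in> J" "i' \<in> V" "?f (a + (m - 1)) = Inr (e', i')" "p = s e' i'"
          using nbr_Inl cyc_step[OF cs, of "a + (m - 1)"] by metis
        have "?f (Suc a + (m - 2)) \<noteq> ?f (Suc a)"
          using m by (intro cyc_add_neq[OF cs]) (auto simp: m_def)
        moreover have "Suc a + (m - 2) = a + (m - 1)" using m by simp
        ultimately have "?f (a + (m - 1)) \<noteq> ?f (Suc a)" by (simp only: not_False_eq_True)
        then have "(e', i') \<noteq> (e, i)" unfolding e(3) e'(3) by simp
        then have "e \<noteq> e'" using inj e e' by (auto dest: inj_onD)
        moreover have "Inr (e, i) \<in> set cs" "Inr (e', i') \<in> set cs"
          unfolding range[symmetric] e(3)[symmetric] e'(3)[symmetric] by (rule rangeI)+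
        then have "e \<in> F" "e' \<in> F" unfolding F_def by blast+
        ultimately show ?thesis using e(2,4) e'(2,4) by blast
      qed
      \<comment> \<open>A copy that the cycle never left would contain all of it, but the cycle
        passes through a point.\<close>
      have exit: "\<exists>p j i. ?f j = Inr (e, i) \<and> ?f (Suc j) = Inl p" if e: "e \<in> F" for e
      proof (rule ccontr)
        assume no: "\<not> ?thesis"
        obtain i where "Inr (e, i) \<in> range ?f" using e unfolding range F_def by blast
        then obtain a where a: "?f a = Inr (e, i)" by (metis imageE)
        have "\<exists>i. ?f k = Inr (e, i)" for k
        proof (rule cyc_invariant[OF cs, where P = "\<lambda>v. \<exists>i. v = Inr (e, i)" and a = a])
          fix k assume "\<exists>i. ?f k = Inr (e, i)"
          then show "\<exists>i. ?f (Suc k) = Inr (e, i)"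
            using cyc_step[OF cs, of k] no by (cases "?f (Suc k)") auto
        qed (use a in auto)
        then show False using True range by (metis imageE sum.distinct(1))
      qed
      then obtain \<phi> where \<phi>: "\<And>e. e \<in> F \<Longrightarrow> \<exists>j i. ?f j = Inr (e, i) \<and> ?f (Suc j) = Inl (\<phi> e)" by metis
      \<comment> \<open>A point has only one predecessor on the cycle, so it is the chosen exit of
        at most one copy.\<close>
      have "inj_on \<phi> F"
      proof (rule inj_onI)
        fix e e' assume "e \<in> F" "e' \<in> F" and eq: "\<phi> e = \<phi> e'"
        then obtain j i j' i' where j: "?f j = Inr (e, i)" "?f (Suc j) = Inl (\<phi> e)"
          and j': "?f j' = Inr (e', i')" "?f (Suc j') = Inl (\<phi> e')" using \<phi> by metis
        have "Suc j mod m = Suc j' mod m" using cyc_eq_iff[OF cs] j j' eq m_def by metis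
        then have "(Suc j + (m - 1)) mod m = (Suc j' + (m - 1)) mod m" by (rule mod_add_cong) simp
        moreover have "Suc j + (m - 1) = j + m" "Suc j' + (m - 1) = j' + m" using m by auto
        ultimately have "(j + m) mod m = (j' + m) mod m" by (simp only:)
        then have "?f j = ?f j'" using cyc_eq_iff[OF cs, of j j'] by (simp add: m_def)
        then show "e = e'" using j j' by simp
      qed
      moreover have "\<phi> ` F \<subseteq> Y" using \<phi> range unfolding Y_def by (auto; metis rangeI)
      ultimately have FY: "card F \<le> card Y" using card_inj_on_le finY by blast
      obtain p where "p \<in> Y" using True unfolding Y_def by blast
      then have "F \<noteq> {}" using two by blast
      let ?U = "\<Union>e\<in>F. s e ` V"
      have finU: "finite ?U" using finF V by simp
      have YU: "Y \<subseteq> ?U" using two by blast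
      \<comment> \<open>Incidences between \<open>F\<close> and its points are counted in two ways:
        each point lies on at least one hyperedge, each point of \<open>Y\<close> on at least
        two.\<close>
      have "(\<Sum>p\<in>?U. if p \<in> Y then 1 else 0) = card Y"
        using finU YU by (simp add: sum.If_cases Int_absorb1)
      then have "card ?U + card Y = (\<Sum>p\<in>?U. 1 + (if p \<in> Y then 1 else 0))"
        unfolding sum.distrib by simp
      also have "\<dots> \<le> (\<Sum>p\<in>?U. card {e\<in>F. p \<in> s e ` V})"
      proof (rule sum_mono)
        fix p assume p: "p \<in> ?U"
        show "1 + (if p \<in> Y then 1 else 0) \<le> card {e\<in>F. p \<in> s e ` V}"
        proof (cases "p \<in> Y")
          case True
          then obtain e e' where "e \<noteq> e'" "{e, e'} \<subseteq> {e\<in>F. p \<in> s e ` V}" using two by blast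
          then show ?thesis using card_mono[of "{e\<in>F. p \<in> s e ` V}" "{e, e'}"] finF True by simp
        next
          case False
          have "{e\<in>F. p \<in> s e ` V} \<noteq> {}" using p by blast
          then show ?thesis using finF False by (simp add: Suc_le_eq card_gt_0_iff)
        qed
      qed
      also have "\<dots> = (\<Sum>e\<in>F. card V)"
      proof (rule sum_multicount_gen[OF finU finF], intro ballI)
        fix e assume "e \<in> F"
        then have "{p\<in>?U. p \<in> s e ` V} = s e ` V" by blast
        then show "card {p\<in>?U. p \<in> s e ` V} = card V" using \<open>e \<in> F\<close> FJ inj by (simp add: card_image subsetD)
      qed
      finally have "card ?U + card F \<le> card V * card F" using FY by (simp add: mult.commute)
      \<comment> \<open>Sparsity applies to \<open>F\<close> because
        \<open>card F \<le> card Y \<le> length cs < g\<close>.\<close>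
      moreover have "(card V - 1) * card F < card ?U"
        using FJ \<open>F \<noteq> {}\<close> FY Ylen short by (intro sparse) auto
      moreover have "card V * card F = (card V - 1) * card F + card F"
        using V by (cases "card V") (auto simp: card_gt_0_iff)
      ultimately show False by linarith
    qed
  qed
qed

section \<open>Coding by natural numbers and the induction on the number of colours\<close>

text \<open>Each round of the construction yields vertices, coordinates and labels of new types;
  coding them by natural numbers keeps the types fixed along the induction.\<close>

lemma axis_labelling_transfer:
  fixes V :: "'v::countable set" and L :: "'c::countable \<Rightarrow> 'v \<Rightarrow> 'l::countable"
  assumes G: "simple_graph V E" "girth_at_least V E g" "\<nexists>c. proper_vertex_colouring V E c k"
    and L: "axis_labelling E L"
  shows "\<exists>(V' :: nat set) E' (L' :: nat \<Rightarrow> nat \<Rightarrow> nat). simple_graph V' E' \<and> girth_at_least V' E' g \<and>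
    (\<nexists>c. proper_vertex_colouring V' E' c k) \<and> axis_labelling E' L'"
proof (intro exI conjI)
  let ?d = "from_nat :: nat \<Rightarrow> 'v"
  let ?V = "to_nat ` V"
  let ?E = "\<lambda>a b. a \<in> ?V \<and> b \<in> ?V \<and> E (?d a) (?d b)"
  \<comment> \<open>Numbers that code no coordinate get the constant label 0, so no edge changes
    them.\<close>
  let ?L = "\<lambda>c a. if c \<in> range (to_nat :: 'c \<Rightarrow> nat) then to_nat (L (from_nat c) (?d a)) else 0"
  have EV: "x \<in> V" "y \<in> V" if "E x y" for x y using G(1) that by (auto simp: simple_graph_def)
  show "simple_graph ?V ?E" using G(1) by (auto simp: simple_graph_def)
  show "girth_at_least ?V ?E g"
    unfolding girth_at_least_def
  proof (intro allI impI)
    fix cs assume cs: "is_cycle ?V ?E cs"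
    have inj: "inj_on ?d ?V" by (auto intro!: inj_onI)
    have "is_cycle V E (map ?d cs)"
      unfolding is_cycle_def
    proof (intro conjI allI impI)
      show "3 \<le> length (map ?d cs)" using cs by (simp add: is_cycle_def)
      show "distinct (map ?d cs)"
        using cs inj_on_subset[OF inj] by (simp add: is_cycle_def distinct_map)
      show "set (map ?d cs) \<subseteq> V" using cs by (auto simp: is_cycle_def)
      fix i assume "i < length (map ?d cs)"
      then have i: "i < length cs" by simp
      then have "(i + 1) mod length cs < length cs" by (intro mod_less_divisor) linarith
      then show "E (map ?d cs ! i) (map ?d cs ! ((i + 1) mod length (map ?d cs)))"
        using cs i by (simp add: is_cycle_def)
    qed
    then show "g \<le> length cs" using G(2) unfolding girth_at_least_def by fastforce
  qed
  show "\<nexists>c. proper_vertex_colouring ?V ?E c k"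
  proof
    assume "\<exists>c. proper_vertex_colouring ?V ?E c k"
    then obtain c where "proper_vertex_colouring ?V ?E c k" by (rule exE)
    then have "proper_vertex_colouring V E (\<lambda>x. c (to_nat x)) k"
      using EV by (auto simp: proper_vertex_colouring_def)
    then show False using G(3) by blast
  qed
  have change: "?L c a \<noteq> ?L c b \<longleftrightarrow> (\<exists>c'. c = to_nat c' \<and> L c' (?d a) \<noteq> L c' (?d b))" for c a b
    by auto
  show "axis_labelling ?E ?L"
    unfolding axis_labelling_def change
  proof (intro conjI allI impI)
    fix a b assume "?E a b"
    then obtain c where "\<And>c'. L c' (?d a) \<noteq> L c' (?d b) \<longleftrightarrow> c' = c"
      using L unfolding axis_labelling_def by blast
    then show "\<exists>!c. \<exists>c'. c = to_nat c' \<and> L c' (?d a) \<noteq> L c' (?d b)" by auto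
  next
    fix a b b' c
    assume E: "?E a b" "?E a b'"
      and c: "\<exists>c'. c = to_nat c' \<and> L c' (?d a) \<noteq> L c' (?d b)"
        "\<exists>c'. c = to_nat c' \<and> L c' (?d a) \<noteq> L c' (?d b')"
    then obtain c' where "L c' (?d a) \<noteq> L c' (?d b)" "L c' (?d a) \<noteq> L c' (?d b')"
      by (metis from_nat_to_nat)
    then have "?d b = ?d b'" using L E unfolding axis_labelling_def by metis
    then show "b = b'" using E by auto
  qed
qed

lemma exists_axis_labelled_graph:
  "\<exists>(V :: nat set) E (L :: nat \<Rightarrow> nat \<Rightarrow> nat). simple_graph V E \<and> girth_at_least V E g \<and>
    (\<nexists>c. proper_vertex_colouring V E c k) \<and> axis_labelling E L"
proof (induction k)
  case 0
  \<comment> \<open>One vertex rather than none: the empty graph is colourable with 0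
    colours.\<close>
  have "simple_graph {0::nat} (\<lambda>_ _. False)" by (simp add: simple_graph_def)
  moreover have "girth_at_least {0::nat} (\<lambda>_ _. False) g"
    by (auto simp: girth_at_least_def is_cycle_def dest: spec[where x = 0])
  moreover have "\<nexists>c. proper_vertex_colouring {0::nat} (\<lambda>_ _. False) c 0"
    by (simp add: proper_vertex_colouring_def)
  moreover have "axis_labelling (\<lambda>_ _. False) (\<lambda>(_::nat) (_::nat). 0::nat)"
    by (simp add: axis_labelling_def)
  ultimately show ?case by blast
next
  case (Suc k)
  then obtain V :: "nat set" and E and L :: "nat \<Rightarrow> nat \<Rightarrow> nat"
    where G: "simple_graph V E" "girth_at_least V E g" "\<nexists>c. proper_vertex_colouring V E c k"
      and L: "axis_labelling E L"
    by (elim exE conjE)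
  have V: "finite V" using G(1) by (simp add: simple_graph_def)
  have "V \<noteq> {}"
  proof
    assume "V = {}"
    then have "proper_vertex_colouring V E (\<lambda>_. 0) k"
      using G(1) by (simp add: proper_vertex_colouring_def simple_graph_def)
    then show False using G(3) by blast
  qed
  obtain M where M: "hj V (Suc k) M" using hales_jewett[OF V] by blast
  let ?X = "words V M" and ?H = "inst ` templates V M"
  have X: "finite ?X" using V by (rule finite_words)
  have "finite (templates V M)"
    unfolding templates_def
    by (rule finite_subset[OF _ finite_lists_length_eq[of "insert None (Some ` V)" M]]) (use V in auto)
  then have H: "finite ?H" "?H \<subseteq> V \<rightarrow> ?X" by (auto intro: inst_words)
  have ncol: "\<forall>\<chi> :: nat list \<Rightarrow> nat. (\<forall>x\<in>?X. \<chi> x < Suc k) \<longrightarrow> (\<exists>h\<in>?H. monochromatic \<chi> h V)"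
  proof (intro allI impI)
    fix \<chi> :: "nat list \<Rightarrow> nat" assume "\<forall>x\<in>?X. \<chi> x < Suc k"
    then have "card (\<chi> ` ?X) \<le> card {..<Suc k}" by (intro card_mono) auto
    then have "card (\<chi> ` ?X) \<le> Suc k" by simp
    then show "\<exists>h\<in>?H. monochromatic \<chi> h V" using M unfolding hj_def by blast
  qed
  obtain J :: "nat set" and s :: "nat \<Rightarrow> nat \<Rightarrow> nat list \<times> nat" and N :: nat
    where J: "finite J"
      and s: "\<forall>e\<in>J. \<exists>h\<in>?H. \<forall>v\<in>V. fst (s e v) = h v \<and> snd (s e v) < N"
      and mono: "\<forall>\<chi> :: nat list \<times> nat \<Rightarrow> nat. (\<forall>p\<in>?X \<times> {..<N}. \<chi> p < Suc k) \<longrightarrow>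
        (\<exists>e\<in>J. monochromatic \<chi> (s e) V)"
      and sparse: "\<forall>F\<subseteq>J. F \<noteq> {} \<longrightarrow> card F \<le> g \<longrightarrow> (card V - 1) * card F < card (\<Union>e\<in>F. s e ` V)"
    by (rule sparse_blow_up[OF V \<open>V \<noteq> {}\<close> X H _ ncol, of g]) simp
  have line: "\<exists>l\<in>templates V M. \<forall>i\<in>V. fst (s e i) = inst l i" if "e \<in> J" for e
    using bspec[OF s that] by blast
  have inj: "inj_on (s e) V" if e: "e \<in> J" for e
  proof (rule inj_onI)
    fix i j assume ij: "i \<in> V" "j \<in> V" "s e i = s e j"
    obtain l where l: "l \<in> templates V M" "\<forall>i\<in>V. fst (s e i) = inst l i" using line[OF e] by blast
    \<comment> \<open>With \<open>id\<close> as the letter map, \<open>map_inst_eq_iff\<close>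
      recovers the letter from the word underlying a lifted point.\<close>
    then have "map id (inst l i) = map id (inst l j)" using ij by (metis list.map_id)
    then show "i = j" using l(1) by (subst (asm) map_inst_eq_iff) (auto simp: templates_def)
  qed
  have sP: "s e i \<in> ?X \<times> {..<N}" if ei: "e \<in> J" "i \<in> V" for e i
  proof -
    obtain h where h: "h \<in> ?H" "\<forall>v\<in>V. fst (s e v) = h v \<and> snd (s e v) < N" using bspec[OF s ei(1)] by blast
    then have "h i \<in> ?X" using H(2) ei(2) by blast
    then show ?thesis using h(2) ei(2) by (simp add: mem_Times_iff)
  qed
  show ?case
  proof (rule axis_labelling_transfer)
    show "simple_graph (Inl ` (?X \<times> {..<N}) \<union> Inr ` (J \<times> V)) (tutte_adj E V J s)"
      using G(1) X J sP by (intro tutte_simple_graph) auto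
    show "girth_at_least (Inl ` (?X \<times> {..<N}) \<union> Inr ` (J \<times> V)) (tutte_adj E V J s) g"
      using G(2) V \<open>V \<noteq> {}\<close> inj sparse[rule_format] by (rule tutte_girth)
    show "\<nexists>c. proper_vertex_colouring (Inl ` (?X \<times> {..<N}) \<union> Inr ` (J \<times> V)) (tutte_adj E V J s) c (Suc k)"
      using G(3) mono[THEN spec, THEN mp] sP G(1) by (rule tutte_not_colourable)
    show "axis_labelling (tutte_adj E V J s) (tutte_label L s)"
      using L G(1) line inj by (rule tutte_axis_labelling)
  qed
qed

lemma chromatic_number_gt:
  fixes V :: "nat set"
  assumes "simple_graph V E" and ncol: "\<nexists>c. proper_vertex_colouring V E c k"
  shows "k < chromatic_number V E"
proof -
  have "finite V" using assms(1) by (simp add: simple_graph_def)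
  \<comment> \<open>Colouring each vertex by itself shows that some number of colours suffices, so
    the \<open>LEAST\<close> in \<open>chromatic_number\<close> is attained.\<close>
  then have "proper_vertex_colouring V E (\<lambda>x. x) (Suc (Max V))"
    using assms(1) by (auto simp: proper_vertex_colouring_def simple_graph_def less_Suc_eq_le)
  then have "\<exists>n c. proper_vertex_colouring V E c n" by blast
  then have "\<exists>c. proper_vertex_colouring V E c (chromatic_number V E)"
    unfolding chromatic_number_def by (rule LeastI_ex)
  then obtain c where c: "proper_vertex_colouring V E c (chromatic_number V E)" by (rule exE)
  show ?thesis
  proof (rule ccontr)
    assume "\<not> k < chromatic_number V E"
    then have "proper_vertex_colouring V E c k"
      using c by (auto simp: proper_vertex_colouring_def intro: less_le_trans)
    then show False using ncol by blast
  qed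
qed

theorem theorem1p1:
  fixes g k :: nat
  assumes "g \<ge> 1" and "k \<ge> 1"
  shows "\<exists>(V :: nat set) (E :: nat \<Rightarrow> nat \<Rightarrow> bool) (col :: nat set \<Rightarrow> nat).
           simple_graph V E \<and> girth_at_least V E g \<and> chromatic_number V E \<ge> k
           \<and> proper_edge_colouring V E col \<and> no_colour_once_on_cycles V E col"
proof -
  obtain V :: "nat set" and E and L :: "nat \<Rightarrow> nat \<Rightarrow> nat"
    where G: "simple_graph V E" "girth_at_least V E g" "\<nexists>c. proper_vertex_colouring V E c k"
      and L: "axis_labelling E L"
    using exists_axis_labelled_graph[of g k] by (elim exE conjE)
  have "k \<le> chromatic_number V E" using chromatic_number_gt[OF G(1,3)] by simp
  then show ?thesis
    using G axis_proper[OF G(1) L] axis_no_colour_once[OF L] by blast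
qed

end
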